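(* Let $k\geq 2$ be a fixed integer. Then, uniformly for integers $n\geq 1$ and real $u_1,\ldots,u_{k-1}\geq 0$ satisfying $u_1+\cdots+u_{k-1}\leq 1$, \[ \frac{1}{n!}\sum_{\sigma\in S_n}\frac{1}{\tau_k(\sigma)}\ \#\left\{(A_1,\ldots,A_k):\ [n]=A_1\sqcup\cdots\sqcup A_k,\ \sigma(A_i)=A_i\ (1\leq i\leq k),\ |A_i|\leq nu_i\ (1\leq i\leq k-1)\right\} = F(u_1,\ldots,u_{k-1})+O\!\left(n^{-1/k}\right), \] where the implied constant depends only on $k$.
   Context: $[n]=\{1,\ldots,n\}$; $S_n$ is the group of permutations of $[n]$; the tuples $(A_1,\ldots,A_k)$ are ordered tuples of (possibly empty) pairwise disjoint subsets with union $[n]$. For $\sigma\in S_n$, $c(\sigma)$ is the number of disjoint cycles of $\sigma$ and $\tau_k(\sigma)=k^{c(\sigma)}$. The function \[F(u_1,\ldots,u_{k-1})=\frac{1}{\Gamma(1/k)^k}\int_0^{u_1}\cdots\int_0^{u_{k-1}} t_1^{\frac1k-1}\cdots t_{k-1}^{\frac1k-1}(1-t_1-\cdots-t_{k-1})^{\frac1k-1}\,dt_1\cdots dt_{k-1}\] is the distribution function of $\mathrm{Dir}(\frac1k,\ldots,\frac1k)$. *)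

theory Defs
  imports "HOL-Analysis.Analysis" "HOL-Combinatorics.Orbits"
begin

text \<open>Fixed points count as cycles of length one, so the cycles of a permutation
  \<open>\<sigma>\<close> of \<open>{1..n}\<close> correspond to its distinct orbits on \<open>{1..n}\<close>.\<close>

definition num_cycles :: "nat \<Rightarrow> (nat \<Rightarrow> nat) \<Rightarrow> nat" where
  "num_cycles n \<sigma> = card (orbit \<sigma> ` {1..n})"

definition tau :: "nat \<Rightarrow> nat \<Rightarrow> (nat \<Rightarrow> nat) \<Rightarrow> nat" where
  "tau k n \<sigma> = k ^ num_cycles n \<sigma>"

text \<open>Tuples \<open>(A\<^sub>1, \<dots>, A\<^sub>k)\<close> are extensional functions on \<open>{1..k}\<close>, so that each tuple is
  counted once. Only \<open>u 1, \<dots>, u (k - 1)\<close> matter.\<close>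

definition invariant_tuples ::
    "nat \<Rightarrow> nat \<Rightarrow> (nat \<Rightarrow> real) \<Rightarrow> (nat \<Rightarrow> nat) \<Rightarrow> (nat \<Rightarrow> nat set) set" where
  "invariant_tuples k n u \<sigma> =
     {A \<in> {1..k} \<rightarrow>\<^sub>E Pow {1..n}.
        disjoint_family_on A {1..k} \<and> (\<Union>i\<in>{1..k}. A i) = {1..n} \<and>
        (\<forall>i\<in>{1..k}. \<sigma> ` A i = A i) \<and>
        (\<forall>i\<in>{1..<k}. real (card (A i)) \<le> real n * u i)}"

text \<open>Distribution function of \<open>Dir(1/k, \<dots>, 1/k)\<close>, as a Lebesgue integral over the box
  \<open>[0, u\<^sub>1] \<times> \<dots> \<times> [0, u\<^sub>k\<^sub>-\<^sub>1]\<close>. It is meant for \<open>u i \<ge> 0\<close> with \<open>\<Sum>i. u i \<le> 1\<close>: then all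
  bases below are nonnegative on the box, and they vanish only on a null set.\<close>

definition dirichlet_cdf :: "nat \<Rightarrow> (nat \<Rightarrow> real) \<Rightarrow> real" where
  "dirichlet_cdf k u =
     1 / Gamma (1 / real k) ^ k *
     (LINT t : (\<Pi>\<^sub>E i\<in>{1..<k}. {0..u i}) | (\<Pi>\<^sub>M i\<in>{1..<k}. lborel).
        (\<Prod>i\<in>{1..<k}. t i powr (1 / real k - 1)) *
        (1 - (\<Sum>i\<in>{1..<k}. t i)) powr (1 / real k - 1))"

end

theory Submission
  imports Defs "HOL-Probability.Probability_Measure"
begin

text \<open>Summing \<open>1 / \<tau>\<^sub>k(\<sigma>)\<close> over the permutations that preserve a colouring of \<open>[n]\<close> with colour
  counts \<open>m\<^sub>1, \<dots>, m\<^sub>k\<close> gives a product of rising factorials. Divided by \<open>n!\<close> it is the moment of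
  exponents \<open>m\<^sub>1, \<dots>, m\<^sub>k\<close> of \<open>X \<sim> Dir(1/k, \<dots>, 1/k)\<close>. So the left-hand side is the probability
  that \<open>n\<close> independent colours, drawn with the random law \<open>X\<close>, have counts \<open>N\<^sub>i \<le> n u\<^sub>i\<close> for
  \<open>i < k\<close>. By a union bound its distance to \<open>F(u) = P(\<forall>i<k. X\<^sub>i \<le> u\<^sub>i)\<close> is at most the sum over \<open>i\<close> of the
  probability that only one of \<open>N\<^sub>i \<le> n u\<^sub>i\<close> and \<open>X\<^sub>i \<le> u\<^sub>i\<close> holds. Given \<open>X\<^sub>i = y\<close>, Chebyshev's
  inequality bounds the latter by \<open>2v / (v + n(y - u\<^sub>i)\<^sup>2)\<close> with \<open>v = y(1 - y)\<close>, and integrating this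
  against the law \<open>Beta(1/k, 1 - 1/k)\<close> of \<open>X\<^sub>i\<close> gives \<open>O(n\<^bsup>-1/k\<^esup>)\<close>.\<close>

subsection \<open>Permutations preserving a colouring\<close>

text \<open>If \<open>p\<close> fixes \<open>a\<close>, this puts \<open>a\<close> in front of \<open>b\<close> in the cycle of \<open>b\<close>; for \<open>b = a\<close> it is
  \<open>p\<close> itself.\<close>

abbreviation insert_in_cycle :: "'a \<Rightarrow> 'a \<Rightarrow> ('a \<Rightarrow> 'a) \<Rightarrow> 'a \<Rightarrow> 'a" where
  "insert_in_cycle a b p \<equiv> Transposition.transpose a b \<circ> p"

lemma orbit_insert_in_cycle_contract:
  assumes p: "p permutes S" "a \<notin> S" and x: "x \<noteq> a" and y: "y \<in> orbit (insert_in_cycle a b p) x"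
  shows "(if y = a then b else y) \<in> orbit p x"
proof -
  let ?contract = "\<lambda>y. if y = a then b else y"
  have "p y = a \<longleftrightarrow> y = a" for y
    using permutes_not_in[OF p] permutes_inj[OF p(1)] by (metis injD)
  then have contract_step: "?contract (insert_in_cycle a b p y) = (if y = a then b else p y)" for y
    by (auto simp: Transposition.transpose_def)
  from y show ?thesis
  proof induction
    case base
    then show ?case using x contract_step[of x] by (auto intro: orbit.base)
  next
    case (step y)
    then show ?case using contract_step[of y] by (auto intro: orbit.step split: if_splits)
  qed
qed

lemma orbit_subset_orbit_insert_in_cycle:
  assumes p: "p permutes S" "a \<notin> S" and x: "x \<in> S"
  shows "orbit p x \<subseteq> orbit (insert_in_cycle a b p) x"
proof
  let ?s = "insert_in_cycle a b p"
  have detour: "p y \<in> orbit ?s x" if "?s y \<in> orbit ?s x" "y \<in> S" for y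
  proof (cases "p y = b")
    case True
    then have "a \<in> orbit ?s x" using that(1) by simp
    then have "?s a \<in> orbit ?s x" by (rule orbit.step)
    then show ?thesis using True permutes_not_in[OF p] by simp
  next
    case False
    moreover have "p y \<noteq> a" using p that(2) permutes_in_image by metis
    ultimately show ?thesis using that(1) by simp
  qed
  show "y \<in> orbit ?s x" if "y \<in> orbit p x" for y
    using that
  proof induction
    case base
    show ?case using x by (intro detour orbit.base)
  next
    case (step y)
    then show ?case using permutes_orbit_subset[OF p(1) x] by (intro detour orbit.step) auto
  qed
qed

lemma orbit_insert_in_cycle_Int:
  assumes p: "p permutes S" "a \<notin> S" and x: "x \<in> S"
  shows "orbit (insert_in_cycle a b p) x \<inter> S = orbit p x"
proof
  have "x \<noteq> a" using x p(2) by auto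
  then have "y \<in> orbit p x" if "y \<in> orbit (insert_in_cycle a b p) x" "y \<in> S" for y
    using orbit_insert_in_cycle_contract[OF p _ that(1)] that(2) p(2) by (auto split: if_splits)
  then show "orbit (insert_in_cycle a b p) x \<inter> S \<subseteq> orbit p x" by blast
  show "orbit p x \<subseteq> orbit (insert_in_cycle a b p) x \<inter> S"
    using orbit_subset_orbit_insert_in_cycle[OF p x] permutes_orbit_subset[OF p(1) x] by blast
qed

lemma insert_in_cycle_permutes:
  "p permutes S \<Longrightarrow> b \<in> insert a S \<Longrightarrow> insert_in_cycle a b p permutes insert a S"
  by (intro permutes_compose[OF permutes_subset] permutes_swap_id) auto

lemma card_orbits_insert_in_cycle:
  assumes p: "p permutes S" "a \<notin> S" and S: "finite S" and b: "b \<in> S"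
  shows "card (orbit (insert_in_cycle a b p) ` insert a S) = card (orbit p ` S)"
proof -
  let ?s = "insert_in_cycle a b p"
  have "?s permutes insert a S" using p(1) b by (intro insert_in_cycle_permutes) auto
  then have perm: "permutation ?s" using S by (auto simp: permutation_permutes)
  have orbit_eq: "orbit ?s x = orbit ?s y" if "y \<in> orbit ?s x" for x y
    using orbit_cyclic_eq3[OF cyclic_on_orbit'[OF perm] that] by simp
  have "?s a = b" using permutes_not_in[OF p] by simp
  then have "orbit ?s a = orbit ?s b" by (metis orbit.base orbit_eq)
  then have "orbit ?s ` insert a S = orbit ?s ` S" using b by auto
  moreover have "inj_on (\<lambda>X. X \<inter> S) (orbit ?s ` S)"
  proof (rule inj_onI, clarify)
    fix x y assume "x \<in> S" "y \<in> S" "orbit ?s x \<inter> S = orbit ?s y \<inter> S"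
    then have "y \<in> orbit ?s x" using permutation_self_in_orbit[OF perm, of y] by blast
    then show "orbit ?s x = orbit ?s y" by (rule orbit_eq)
  qed
  moreover have "(\<lambda>X. X \<inter> S) ` orbit ?s ` S = orbit p ` S"
    unfolding image_image using orbit_insert_in_cycle_Int[OF p] by (intro image_cong) auto
  ultimately show ?thesis by (metis card_image)
qed

lemma card_orbits_insert_fixed_point:
  assumes p: "p permutes S" "a \<notin> S" and S: "finite S"
  shows "card (orbit p ` insert a S) = Suc (card (orbit p ` S))"
proof -
  have "permutation p" using p S by (auto simp: permutation_permutes)
  then have "a \<in> orbit p a" by (rule permutation_self_in_orbit)
  moreover have "orbit p x \<subseteq> S" if "x \<in> S" for x
    by (rule permutes_orbit_subset[OF p(1) that])
  ultimately have "orbit p a \<notin> orbit p ` S" using p(2) by blast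
  then show ?thesis using S by simp
qed

abbreviation colour_class :: "'a set \<Rightarrow> ('a \<Rightarrow> 'i) \<Rightarrow> 'i \<Rightarrow> 'a set" where
  "colour_class S \<kappa> i \<equiv> {x \<in> S. \<kappa> x = i}"

definition colour_stabilizer :: "('a \<Rightarrow> 'i) \<Rightarrow> 'a set \<Rightarrow> ('a \<Rightarrow> 'a) set" where
  "colour_stabilizer \<kappa> S = {p. p permutes S \<and> (\<forall>x\<in>S. \<kappa> (p x) = \<kappa> x)}"

lemma sum_colour_stabilizer:
  assumes "finite S"
  shows "(\<Sum>p\<in>colour_stabilizer \<kappa> S. f p)
       = (\<Sum>p | p permutes S. if p \<in> colour_stabilizer \<kappa> S then f p else 0)"
proof -
  have "colour_stabilizer \<kappa> S = {p. p permutes S} \<inter> colour_stabilizer \<kappa> S"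
    by (auto simp: colour_stabilizer_def)
  then show ?thesis
    using sum.inter_restrict[OF finite_permutations[OF assms], of f "colour_stabilizer \<kappa> S"] by simp
qed

lemma insert_in_cycle_in_colour_stabilizer_iff:
  assumes p: "p permutes S" "a \<notin> S" and b: "b \<in> insert a S"
  shows "insert_in_cycle a b p \<in> colour_stabilizer \<kappa> (insert a S)
    \<longleftrightarrow> \<kappa> b = \<kappa> a \<and> p \<in> colour_stabilizer \<kappa> S"
proof -
  have "\<kappa> (Transposition.transpose a b y) = \<kappa> y" if "\<kappa> b = \<kappa> a" for y
    using that by (auto simp: Transposition.transpose_def)
  then show ?thesis
    using p insert_in_cycle_permutes[OF p(1) b] permutes_not_in[OF p]
    by (auto simp: colour_stabilizer_def)
qed

lemma sum_colour_stabilizer_insert: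
  fixes f :: "('a \<Rightarrow> 'a) \<Rightarrow> 'b :: comm_monoid_add"
  assumes S: "finite S" and a: "a \<notin> S"
  shows "(\<Sum>p\<in>colour_stabilizer \<kappa> (insert a S). f p)
       = (\<Sum>b\<in>colour_class (insert a S) \<kappa> (\<kappa> a). \<Sum>p\<in>colour_stabilizer \<kappa> S. f (insert_in_cycle a b p))"
proof -
  let ?f = "\<lambda>b p. f (insert_in_cycle a b p)"
  have "(\<Sum>p\<in>colour_stabilizer \<kappa> (insert a S). f p)
      = (\<Sum>b\<in>insert a S. \<Sum>p | p permutes S. if \<kappa> b = \<kappa> a \<and> p \<in> colour_stabilizer \<kappa> S then ?f b p else 0)"
    unfolding sum_colour_stabilizer[OF finite.insertI[OF S]] sum_over_permutations_insert[OF S a]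
    using a by (intro sum.cong) (auto simp: insert_in_cycle_in_colour_stabilizer_iff)
  also have "\<dots> = (\<Sum>b\<in>insert a S. if \<kappa> b = \<kappa> a then \<Sum>p\<in>colour_stabilizer \<kappa> S. ?f b p else 0)"
    unfolding sum_colour_stabilizer[OF S] by (intro sum.cong) auto
  finally show ?thesis using S by (simp only: sum.inter_filter finite_insert)
qed

lemma prod_pochhammer_colour_class_insert:
  fixes \<alpha> :: "'b :: comm_semiring_1"
  assumes "finite S" "a \<notin> S" "finite I" "\<kappa> a \<in> I"
  shows "(\<Prod>i\<in>I. pochhammer \<alpha> (card (colour_class (insert a S) \<kappa> i)))
       = (\<alpha> + of_nat (card (colour_class S \<kappa> (\<kappa> a)))) *
         (\<Prod>i\<in>I. pochhammer \<alpha> (card (colour_class S \<kappa> i)))"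
proof -
  have "colour_class (insert a S) \<kappa> i
      = (if i = \<kappa> a then insert a (colour_class S \<kappa> i) else colour_class S \<kappa> i)" for i
    by auto
  then have "card (colour_class (insert a S) \<kappa> i) = card (colour_class S \<kappa> i) + of_bool (i = \<kappa> a)" for i
    using assms by simp
  then show ?thesis
    using assms by (simp add: prod.remove[of I "\<kappa> a"] pochhammer_rec' mult_ac)
qed

theorem sum_power_card_orbits_colour_stabilizer:
  fixes \<alpha> :: "'b :: comm_semiring_1"
  assumes "finite S" "finite I" "\<kappa> ` S \<subseteq> I"
  shows "(\<Sum>p\<in>colour_stabilizer \<kappa> S. \<alpha> ^ card (orbit p ` S))
       = (\<Prod>i\<in>I. pochhammer \<alpha> (card (colour_class S \<kappa> i)))"
  using assms(1,3)
proof (induction S)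
  case empty
  have "colour_stabilizer \<kappa> {} = {id}" by (auto simp: colour_stabilizer_def)
  then show ?case by simp
next
  case (insert a S)
  define B where "B = colour_class S \<kappa> (\<kappa> a)"
  define W where "W = (\<Sum>p\<in>colour_stabilizer \<kappa> S. \<alpha> ^ card (orbit p ` S))"
  have B: "finite B" "a \<notin> B" "colour_class (insert a S) \<kappa> (\<kappa> a) = insert a B"
    using insert.hyps by (auto simp: B_def)
  have fixed: "(\<Sum>p\<in>colour_stabilizer \<kappa> S. \<alpha> ^ card (orbit p ` insert a S)) = \<alpha> * W"
    unfolding W_def sum_distrib_left using insert.hyps
    by (intro sum.cong)
      (auto simp: colour_stabilizer_def card_orbits_insert_fixed_point simp del: image_insert)
  have moved: "(\<Sum>p\<in>colour_stabilizer \<kappa> S. \<alpha> ^ card (orbit (insert_in_cycle a b p) ` insert a S)) = W"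
    if "b \<in> B" for b
    unfolding W_def using that insert.hyps
    by (intro sum.cong)
      (auto simp: colour_stabilizer_def B_def card_orbits_insert_in_cycle simp del: image_insert)
  have "(\<Sum>p\<in>colour_stabilizer \<kappa> (insert a S). \<alpha> ^ card (orbit p ` insert a S))
      = (\<alpha> + of_nat (card B)) * W"
    unfolding sum_colour_stabilizer_insert[OF insert.hyps] B(3)
    using B(1,2) fixed moved by (simp add: distrib_right del: image_insert)
  also have "W = (\<Prod>i\<in>I. pochhammer \<alpha> (card (colour_class S \<kappa> i)))"
    unfolding W_def using insert by auto
  also have "(\<alpha> + of_nat (card B)) * \<dots> = (\<Prod>i\<in>I. pochhammer \<alpha> (card (colour_class (insert a S) \<kappa> i)))"
    unfolding B_def using insert.hyps insert.prems assms(2)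
    by (intro prod_pochhammer_colour_class_insert[symmetric]) auto
  finally show ?case .
qed

lemma sum_card_colour_class:
  assumes "finite S" "finite I" "\<kappa> ` S \<subseteq> I"
  shows "(\<Sum>i\<in>I. card (colour_class S \<kappa> i)) = card S"
  using sum.group[OF assms, of "\<lambda>_. 1 :: nat"] by simp

definition capped_colourings :: "'i set \<Rightarrow> 'i set \<Rightarrow> ('i \<Rightarrow> real) \<Rightarrow> 'a set \<Rightarrow> ('a \<Rightarrow> 'i) set" where
  "capped_colourings I J u S =
     {\<kappa> \<in> S \<rightarrow>\<^sub>E I. \<forall>j\<in>J. real (card (colour_class S \<kappa> j)) \<le> real (card S) * u j}"

lemma finite_capped_colourings: "finite S \<Longrightarrow> finite I \<Longrightarrow> finite (capped_colourings I J u S)"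
  by (simp add: capped_colourings_def finite_PiE)

lemma bij_betw_colour_classes:
  "bij_betw (\<lambda>\<kappa>. \<lambda>i\<in>I. colour_class S \<kappa> i) (S \<rightarrow>\<^sub>E I)
     {A \<in> I \<rightarrow>\<^sub>E Pow S. disjoint_family_on A I \<and> (\<Union>i\<in>I. A i) = S}"
proof (rule bij_betwI')
  fix \<kappa> \<mu> assume \<kappa>: "\<kappa> \<in> S \<rightarrow>\<^sub>E I" and \<mu>: "\<mu> \<in> S \<rightarrow>\<^sub>E I"
  show "(\<lambda>i\<in>I. colour_class S \<kappa> i) = (\<lambda>i\<in>I. colour_class S \<mu> i) \<longleftrightarrow> \<kappa> = \<mu>"
  proof
    assume classes_eq: "(\<lambda>i\<in>I. colour_class S \<kappa> i) = (\<lambda>i\<in>I. colour_class S \<mu> i)"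
    have "\<kappa> x = \<mu> x" if "x \<in> S" for x
    proof -
      have "colour_class S \<kappa> (\<kappa> x) = colour_class S \<mu> (\<kappa> x)"
        using fun_cong[OF classes_eq, of "\<kappa> x"] PiE_mem[OF \<kappa> that] by simp
      moreover have "x \<in> colour_class S \<kappa> (\<kappa> x)" using that by simp
      ultimately have "x \<in> colour_class S \<mu> (\<kappa> x)" by (simp only:)
      then show ?thesis by simp
    qed
    then show "\<kappa> = \<mu>" using \<kappa> \<mu> by (intro PiE_ext) auto
  qed simp
next
  fix \<kappa> assume "\<kappa> \<in> S \<rightarrow>\<^sub>E I"
  then show "(\<lambda>i\<in>I. colour_class S \<kappa> i)
      \<in> {A \<in> I \<rightarrow>\<^sub>E Pow S. disjoint_family_on A I \<and> (\<Union>i\<in>I. A i) = S}"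
    by (auto simp: disjoint_family_on_def)
next
  fix A assume A: "A \<in> {A \<in> I \<rightarrow>\<^sub>E Pow S. disjoint_family_on A I \<and> (\<Union>i\<in>I. A i) = S}"
  then have "\<forall>x\<in>S. \<exists>i. i \<in> I \<and> x \<in> A i" by blast
  then obtain f where f: "\<forall>x\<in>S. f x \<in> I \<and> x \<in> A (f x)" by metis
  then have "f x = i \<longleftrightarrow> x \<in> A i" if "x \<in> S" "i \<in> I" for x i
    using that A unfolding disjoint_family_on_def by blast
  then have "A = (\<lambda>i\<in>I. colour_class S (restrict f S) i)"
    using A by (auto simp: fun_eq_iff PiE_iff extensional_def)
  moreover have "restrict f S \<in> S \<rightarrow>\<^sub>E I" using f by auto
  ultimately show "\<exists>\<kappa>\<in>S \<rightarrow>\<^sub>E I. A = (\<lambda>i\<in>I. colour_class S \<kappa> i)" by blast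
qed

lemma image_colour_class_eq_iff:
  assumes S: "finite S" and p: "p permutes S" and \<kappa>: "\<kappa> \<in> S \<rightarrow>\<^sub>E I"
  shows "(\<forall>i\<in>I. p ` colour_class S \<kappa> i = colour_class S \<kappa> i) \<longleftrightarrow> p \<in> colour_stabilizer \<kappa> S"
proof
  assume "\<forall>i\<in>I. p ` colour_class S \<kappa> i = colour_class S \<kappa> i"
  then have "p x \<in> colour_class S \<kappa> (\<kappa> x)" if "x \<in> S" for x
    using \<kappa> that by blast
  then show "p \<in> colour_stabilizer \<kappa> S" using p by (simp add: colour_stabilizer_def)
next
  assume "p \<in> colour_stabilizer \<kappa> S"
  then have "p ` colour_class S \<kappa> i \<subseteq> colour_class S \<kappa> i" for i
    using p by (auto simp: colour_stabilizer_def permutes_in_image)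
  then show "\<forall>i\<in>I. p ` colour_class S \<kappa> i = colour_class S \<kappa> i"
    using S permutes_inj_on[OF p] by (simp add: endo_inj_surj)
qed

lemma card_invariant_tuples:
  assumes \<sigma>: "\<sigma> permutes {1..n}"
  shows "card (invariant_tuples k n u \<sigma>)
       = card {\<kappa> \<in> capped_colourings {1..k} {1..<k} u {1..n}. \<sigma> \<in> colour_stabilizer \<kappa> {1..n}}"
    (is "_ = card ?colourings")
proof -
  let ?classes = "\<lambda>\<kappa>. \<lambda>i\<in>{1..k}. colour_class {1..n} \<kappa> i"
  let ?partitions = "{A \<in> {1..k} \<rightarrow>\<^sub>E Pow {1..n}.
      disjoint_family_on A {1..k} \<and> (\<Union>i\<in>{1..k}. A i) = {1..n}}"
  let ?admissible = "\<lambda>A. (\<forall>i\<in>{1..k}. \<sigma> ` A i = A i) \<and> (\<forall>i\<in>{1..<k}. real (card (A i)) \<le> real n * u i)"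
  let ?preserved = "\<lambda>\<kappa>. \<sigma> \<in> colour_stabilizer \<kappa> {1..n} \<and>
      (\<forall>j\<in>{1..<k}. real (card (colour_class {1..n} \<kappa> j)) \<le> real n * u j)"
  have "?admissible (?classes \<kappa>) \<longleftrightarrow> ?preserved \<kappa>" if "\<kappa> \<in> {1..n} \<rightarrow>\<^sub>E {1..k}" for \<kappa>
    using image_colour_class_eq_iff[OF _ \<sigma> that] by (simp del: One_nat_def)
  then have "bij_betw ?classes {\<kappa> \<in> {1..n} \<rightarrow>\<^sub>E {1..k}. ?preserved \<kappa>} {A \<in> ?partitions. ?admissible A}"
    by (intro bij_betw_Collect bij_betw_colour_classes)
  moreover have "{A \<in> ?partitions. ?admissible A} = invariant_tuples k n u \<sigma>"
    by (auto simp: invariant_tuples_def)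
  moreover have "{\<kappa> \<in> {1..n} \<rightarrow>\<^sub>E {1..k}. ?preserved \<kappa>} = ?colourings"
    by (auto simp: capped_colourings_def)
  ultimately have "bij_betw ?classes ?colourings (invariant_tuples k n u \<sigma>)"
    by (simp only:)
  then show ?thesis by (rule bij_betw_same_card[symmetric])
qed

theorem sum_invariant_tuples:
  "(\<Sum>\<sigma> | \<sigma> permutes {1..n}. 1 / real (tau k n \<sigma>) * real (card (invariant_tuples k n u \<sigma>)))
     = (\<Sum>\<kappa>\<in>capped_colourings {1..k} {1..<k} u {1..n}.
          \<Prod>i\<in>{1..k}. pochhammer (1 / real k) (card (colour_class {1..n} \<kappa> i)))"
proof -
  let ?S = "{1..n}" and ?\<alpha> = "1 / real k"
  let ?K = "capped_colourings {1..k} {1..<k} u ?S"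
  have "(\<Sum>\<sigma> | \<sigma> permutes ?S. 1 / real (tau k n \<sigma>) * real (card (invariant_tuples k n u \<sigma>)))
      = (\<Sum>\<sigma> | \<sigma> permutes ?S. \<Sum>\<kappa> | \<kappa> \<in> ?K \<and> \<sigma> \<in> colour_stabilizer \<kappa> ?S. ?\<alpha> ^ card (orbit \<sigma> ` ?S))"
    by (intro sum.cong) (auto simp: card_invariant_tuples tau_def num_cycles_def power_one_over)
  also have "\<dots> = (\<Sum>\<kappa>\<in>?K. \<Sum>\<sigma> | \<sigma> \<in> {\<sigma>. \<sigma> permutes ?S} \<and> \<sigma> \<in> colour_stabilizer \<kappa> ?S.
      ?\<alpha> ^ card (orbit \<sigma> ` ?S))"
    by (intro sum.swap_restrict) (auto simp: finite_capped_colourings finite_permutations)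
  also have "\<dots> = (\<Sum>\<kappa>\<in>?K. \<Sum>\<sigma>\<in>colour_stabilizer \<kappa> ?S. ?\<alpha> ^ card (orbit \<sigma> ` ?S))"
    by (intro sum.cong) (auto simp: colour_stabilizer_def)
  also have "\<dots> = (\<Sum>\<kappa>\<in>?K. \<Prod>i\<in>{1..k}. pochhammer ?\<alpha> (card (colour_class ?S \<kappa> i)))"
    by (intro sum.cong sum_power_card_orbits_colour_stabilizer) (auto simp: capped_colourings_def)
  finally show ?thesis .
qed

subsection \<open>Independent random colours\<close>

definition colouring_mean :: "('i \<Rightarrow> real) \<Rightarrow> 'i set \<Rightarrow> 'a set \<Rightarrow> (('a \<Rightarrow> 'i) \<Rightarrow> real) \<Rightarrow> real" where
  "colouring_mean w I S f = (\<Sum>\<kappa>\<in>S \<rightarrow>\<^sub>E I. (\<Prod>x\<in>S. w (\<kappa> x)) * f \<kappa>)"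

lemma colouring_mean_cmult: "colouring_mean w I S (\<lambda>\<kappa>. c * f \<kappa>) = c * colouring_mean w I S f"
  by (simp add: colouring_mean_def sum_distrib_left mult.left_commute)

lemma colouring_mean_diff:
  "colouring_mean w I S (\<lambda>\<kappa>. f \<kappa> - g \<kappa>) = colouring_mean w I S f - colouring_mean w I S g"
  by (simp add: colouring_mean_def sum_subtractf right_diff_distrib)

lemma colouring_mean_sum:
  "colouring_mean w I S (\<lambda>\<kappa>. \<Sum>j\<in>J. f j \<kappa>) = (\<Sum>j\<in>J. colouring_mean w I S (f j))"
  unfolding colouring_mean_def sum_distrib_left by (rule sum.swap)

lemma colouring_mean_const:
  assumes "finite S" "finite I" "sum w I = 1"
  shows "colouring_mean w I S (\<lambda>_. c) = c"
  using prod_sum_PiE[of S "\<lambda>_. I" "\<lambda>_. w"] assms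
  by (simp add: colouring_mean_def sum_distrib_right[symmetric])

lemma colouring_mean_mono:
  assumes "\<And>i. i \<in> I \<Longrightarrow> w i \<ge> 0" "\<And>\<kappa>. \<kappa> \<in> S \<rightarrow>\<^sub>E I \<Longrightarrow> f \<kappa> \<le> g \<kappa>"
  shows "colouring_mean w I S f \<le> colouring_mean w I S g"
  unfolding colouring_mean_def using assms by (intro sum_mono mult_left_mono prod_nonneg) auto

lemma abs_colouring_mean_le:
  assumes "\<And>i. i \<in> I \<Longrightarrow> w i \<ge> 0"
  shows "\<bar>colouring_mean w I S f\<bar> \<le> colouring_mean w I S (\<lambda>\<kappa>. \<bar>f \<kappa>\<bar>)"
proof -
  have "- f \<kappa> \<le> \<bar>f \<kappa>\<bar>" "f \<kappa> \<le> \<bar>f \<kappa>\<bar>" for \<kappa> by auto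
  then have "colouring_mean w I S (\<lambda>\<kappa>. -1 * f \<kappa>) \<le> colouring_mean w I S (\<lambda>\<kappa>. \<bar>f \<kappa>\<bar>)"
    "colouring_mean w I S f \<le> colouring_mean w I S (\<lambda>\<kappa>. \<bar>f \<kappa>\<bar>)"
    using assms by (auto intro!: colouring_mean_mono)
  then show ?thesis unfolding colouring_mean_cmult by linarith
qed

lemma colouring_mean_insert:
  assumes "finite S" "a \<notin> S"
  shows "colouring_mean w I (insert a S) f = (\<Sum>i\<in>I. w i * colouring_mean w I S (\<lambda>\<kappa>. f (\<kappa>(a := i))))"
proof -
  have "(\<Prod>x\<in>S. w ((\<kappa>(a := i)) x)) = (\<Prod>x\<in>S. w (\<kappa> x))" for \<kappa> i
    using assms(2) by (intro prod.cong) auto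
  then have weight: "(\<Prod>x\<in>insert a S. w ((\<kappa>(a := i)) x)) = w i * (\<Prod>x\<in>S. w (\<kappa> x))" for \<kappa> i
    using assms by simp
  have "colouring_mean w I (insert a S) f
      = (\<Sum>(i, \<kappa>)\<in>I \<times> (S \<rightarrow>\<^sub>E I). w i * ((\<Prod>x\<in>S. w (\<kappa> x)) * f (\<kappa>(a := i))))"
    unfolding colouring_mean_def PiE_insert_eq using inj_combinator[OF assms(2), of "\<lambda>_. I"]
    by (simp only: sum.reindex o_def case_prod_unfold weight mult.assoc)
  then show ?thesis
    by (simp add: colouring_mean_def sum.cartesian_product[symmetric] sum_distrib_left)
qed

lemma colouring_mean_of_bool_capped:
  assumes "finite S" "finite I"
  shows "colouring_mean w I S
           (\<lambda>\<kappa>. of_bool (\<forall>j\<in>J. real (card (colour_class S \<kappa> j)) \<le> real (card S) * u j))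
       = (\<Sum>\<kappa>\<in>capped_colourings I J u S. \<Prod>x\<in>S. w (\<kappa> x))"
  unfolding capped_colourings_def colouring_mean_def
  using assms by (subst sum.inter_filter) (auto intro!: finite_PiE sum.cong)

lemma colouring_mean_second_moment:
  assumes "finite S" "finite I" "j \<in> I" "sum w I = 1"
  shows "colouring_mean w I S (\<lambda>\<kappa>. (real (card (colour_class S \<kappa> j)) - c)\<^sup>2)
       = real (card S) * (w j * (1 - w j)) + (real (card S) * w j - c)\<^sup>2"
  using assms(1)
proof (induction S arbitrary: c)
  case empty
  show ?case by (simp add: colouring_mean_def)
next
  case (insert a S)
  let ?E = "\<lambda>c. colouring_mean w I S (\<lambda>\<kappa>. (real (card (colour_class S \<kappa> j)) - c)\<^sup>2)"
  have "colour_class (insert a S) (\<kappa>(a := i)) j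
      = (if i = j then insert a (colour_class S \<kappa> j) else colour_class S \<kappa> j)" for \<kappa> i
    using insert.hyps by auto
  then have count: "real (card (colour_class (insert a S) (\<kappa>(a := i)) j)) - c
      = real (card (colour_class S \<kappa> j)) - (c - of_bool (i = j))" for \<kappa> i
    using insert.hyps by simp
  have "colouring_mean w I (insert a S) (\<lambda>\<kappa>. (real (card (colour_class (insert a S) \<kappa> j)) - c)\<^sup>2)
      = (\<Sum>i\<in>I. w i * ?E (c - of_bool (i = j)))"
    by (simp only: colouring_mean_insert[OF insert.hyps] count)
  also have "\<dots> = w j * ?E (c - 1) + (\<Sum>i\<in>I - {j}. w i) * ?E c"
    using assms by (subst sum.remove[of I j]) (auto simp: sum_distrib_right)
  also have "(\<Sum>i\<in>I - {j}. w i) = 1 - w j"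
    using assms by (simp add: sum.remove[of I j])
  finally show ?case
    unfolding insert.IH using insert.hyps by (simp add: algebra_simps power2_eq_square)
qed

lemma colouring_mean_chebyshev:
  fixes w :: "'i \<Rightarrow> real" and u :: real
  assumes S: "finite S" and I: "finite I" "j \<in> I" and w: "\<And>i. i \<in> I \<Longrightarrow> w i \<ge> 0" "sum w I = 1"
  shows "real (card S) * (w j - u)\<^sup>2 * colouring_mean w I S
           (\<lambda>\<kappa>. of_bool ((real (card (colour_class S \<kappa> j)) \<le> real (card S) * u) \<noteq> (w j \<le> u)))
       \<le> w j * (1 - w j)"
    (is "?n * _ * colouring_mean w I S ?deviates \<le> ?v")
proof (cases "card S = 0")
  case True
  have "w j \<le> 1" using member_le_sum[OF I(2), of w] I(1) w by simp
  then show ?thesis using True w(1)[OF I(2)] by simp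
next
  case False
  let ?N = "\<lambda>\<kappa>. real (card (colour_class S \<kappa> j))"
  have deviates: "(?n * (w j - u))\<^sup>2 * ?deviates \<kappa> \<le> (?N \<kappa> - ?n * w j)\<^sup>2" for \<kappa>
  proof (cases "(?N \<kappa> \<le> ?n * u) = (w j \<le> u)")
    case False
    have "?n * w j \<le> ?n * u \<or> \<not> w j \<le> u" "?n * u \<le> ?n * w j \<or> w j \<le> u"
      by (auto intro: mult_left_mono)
    then have "\<bar>?n * (w j - u)\<bar> \<le> \<bar>?N \<kappa> - ?n * w j\<bar>" using False by (auto simp: right_diff_distrib)
    then show ?thesis by (simp add: abs_le_square_iff)
  qed simp
  have "(?n * (w j - u))\<^sup>2 * colouring_mean w I S ?deviates
      \<le> colouring_mean w I S (\<lambda>\<kappa>. (?N \<kappa> - ?n * w j)\<^sup>2)"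
    unfolding colouring_mean_cmult[symmetric] by (intro colouring_mean_mono w deviates)
  also have "\<dots> = ?n * ?v"
    using colouring_mean_second_moment[OF S I w(2), of "?n * w j"] by simp
  finally have "?n * (?n * (w j - u)\<^sup>2 * colouring_mean w I S ?deviates) \<le> ?n * ?v"
    by (simp only: power_mult_distrib power2_eq_square[of ?n] mult.assoc)
  then show ?thesis using False by simp
qed

text \<open>Chebyshev's inequality bounds a deviation probability by \<open>v / (n (y - u)\<^sup>2)\<close>, where
  \<open>v = y (1 - y)\<close>; combining it with the trivial bound \<open>1\<close> covers \<open>y = u\<close>.\<close>

definition chebyshev_bound :: "real \<Rightarrow> real \<Rightarrow> real \<Rightarrow> real" where
  "chebyshev_bound n u y = 2 * (y * (1 - y)) / (y * (1 - y) + n * (y - u)\<^sup>2)"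

lemma chebyshev_bound_nonneg: "n \<ge> 0 \<Longrightarrow> 0 \<le> y \<Longrightarrow> y \<le> 1 \<Longrightarrow> chebyshev_bound n u y \<ge> 0"
  by (simp add: chebyshev_bound_def)

lemma chebyshev_bound_reflect: "chebyshev_bound n u y = chebyshev_bound n (1 - u) (1 - y)"
  by (simp add: chebyshev_bound_def mult.commute power2_commute)

lemma measurable_chebyshev_bound [measurable]: "chebyshev_bound n u \<in> borel_measurable borel"
  unfolding chebyshev_bound_def by measurable

lemma colouring_mean_deviation_le:
  fixes w :: "'i \<Rightarrow> real" and u :: real
  assumes S: "finite S" and I: "finite I" "j \<in> I" and w: "\<And>i. i \<in> I \<Longrightarrow> w i \<ge> 0" "sum w I = 1"
    and wj: "0 < w j" "w j < 1"
  shows "colouring_mean w I S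
           (\<lambda>\<kappa>. of_bool ((real (card (colour_class S \<kappa> j)) \<le> real (card S) * u) \<noteq> (w j \<le> u)))
       \<le> chebyshev_bound (real (card S)) u (w j)"
    (is "?p \<le> _")
proof -
  define v d where "v = w j * (1 - w j)" and "d = real (card S) * (w j - u)\<^sup>2"
  have "v > 0" "d \<ge> 0" using wj by (auto simp: v_def d_def)
  have "?p \<le> colouring_mean w I S (\<lambda>_. 1)" using w by (intro colouring_mean_mono) auto
  then have "v * ?p \<le> v * 1"
    unfolding colouring_mean_const[OF S I(1) w(2)] using \<open>v > 0\<close> by (intro mult_left_mono) simp_all
  moreover have "d * ?p \<le> v"
    unfolding v_def d_def by (rule colouring_mean_chebyshev[OF S I w])
  ultimately have "?p * (v + d) \<le> 2 * v" by (simp add: algebra_simps)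
  then have "?p \<le> 2 * v / (v + d)"
    using \<open>v > 0\<close> \<open>d \<ge> 0\<close> by (simp add: pos_le_divide_eq)
  then show ?thesis by (simp only: chebyshev_bound_def v_def d_def)
qed

lemma abs_of_bool_Ball_diff_le:
  assumes "finite J"
  shows "\<bar>of_bool (\<forall>j\<in>J. P j) - of_bool (\<forall>j\<in>J. Q j)\<bar> \<le> (\<Sum>j\<in>J. of_bool (P j \<noteq> Q j) :: real)"
proof -
  have "(1 :: real) \<le> (\<Sum>j\<in>J. of_bool (P j \<noteq> Q j))" if "j \<in> J" "P j \<noteq> Q j" for j
    using member_le_sum[of j J "\<lambda>j. of_bool (P j \<noteq> Q j) :: real"] that assms by simp
  then show ?thesis by (auto simp: sum_nonneg)
qed

lemma abs_sum_capped_colourings_diff_le: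
  fixes w u :: "'i \<Rightarrow> real"
  assumes S: "finite S" and I: "finite I" and J: "J \<subseteq> I"
    and w: "\<And>i. i \<in> I \<Longrightarrow> w i \<ge> 0" "sum w I = 1" and wj: "\<And>j. j \<in> J \<Longrightarrow> 0 < w j \<and> w j < 1"
  shows "\<bar>(\<Sum>\<kappa>\<in>capped_colourings I J u S. \<Prod>x\<in>S. w (\<kappa> x))
          - of_bool (\<forall>j\<in>J. w j \<le> u j)\<bar>
       \<le> (\<Sum>j\<in>J. chebyshev_bound (real (card S)) (u j) (w j))"
proof -
  let ?cap = "\<lambda>\<kappa> j. real (card (colour_class S \<kappa> j)) \<le> real (card S) * u j"
  let ?diff = "\<lambda>\<kappa>. of_bool (\<forall>j\<in>J. ?cap \<kappa> j) - of_bool (\<forall>j\<in>J. w j \<le> u j) :: real"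
  have "finite J" using I J by (rule finite_subset[rotated])
  have "(\<Sum>\<kappa>\<in>capped_colourings I J u S. \<Prod>x\<in>S. w (\<kappa> x))
          - of_bool (\<forall>j\<in>J. w j \<le> u j) = colouring_mean w I S ?diff"
    by (simp only: colouring_mean_diff colouring_mean_of_bool_capped[OF S I]
        colouring_mean_const[OF S I w(2)])
  also have "\<bar>\<dots>\<bar> \<le> colouring_mean w I S (\<lambda>\<kappa>. \<bar>?diff \<kappa>\<bar>)"
    using w(1) by (rule abs_colouring_mean_le)
  also have "\<dots> \<le> colouring_mean w I S (\<lambda>\<kappa>. \<Sum>j\<in>J. of_bool (?cap \<kappa> j \<noteq> (w j \<le> u j)))"
    by (intro colouring_mean_mono w abs_of_bool_Ball_diff_le \<open>finite J\<close>)
  also have "\<dots> \<le> (\<Sum>j\<in>J. chebyshev_bound (real (card S)) (u j) (w j))"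
    unfolding colouring_mean_sum using J wj by (intro sum_mono colouring_mean_deviation_le S I w) auto
  finally show ?thesis .
qed

subsection \<open>Dirichlet distributions\<close>

definition power_kernel :: "real \<Rightarrow> real \<Rightarrow> real" where
  "power_kernel a t = (if t > 0 then t powr (a - 1) / Gamma a else 0)"

lemma power_kernel_eq: "t \<ge> 0 \<Longrightarrow> power_kernel a t = t powr (a - 1) / Gamma a"
  by (simp add: power_kernel_def)

lemma power_kernel_nonneg [simp]: "a > 0 \<Longrightarrow> power_kernel a t \<ge> 0"
  by (simp add: power_kernel_def less_imp_le)

lemma measurable_power_kernel [measurable]: "power_kernel a \<in> borel_measurable borel"
  unfolding power_kernel_def by measurable

lemma power_mult_power_kernel:
  assumes "a > 0"
  shows "t ^ m * power_kernel a t = pochhammer a m * power_kernel (a + real m) t"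
proof -
  have "pochhammer a m = Gamma (a + real m) / Gamma a"
    using assms by (intro pochhammer_Gamma) (auto elim!: nonpos_Ints_cases)
  moreover have "t ^ m * t powr (a - 1) = t powr (a + real m - 1)" if "t > 0"
    using that by (simp add: powr_realpow[symmetric] powr_add[symmetric] algebra_simps)
  moreover have "Gamma (a + real m) > 0" using assms by (simp add: add_pos_nonneg)
  ultimately show ?thesis by (simp add: power_kernel_def)
qed

lemma power_kernel_mult_scaled:
  assumes r: "r > 0"
  shows "power_kernel a (r * s) * power_kernel b (r - r * s)
       = r powr (a + b - 2) / (Gamma a * Gamma b) *
         (indicator {0..1} s * (s powr (a - 1) * (1 - s) powr (b - 1)))"
proof (cases "0 < s \<and> s < 1")
  case True
  then have "power_kernel a (r * s) * power_kernel b (r * (1 - s))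
      = r powr (a + b - 2) / (Gamma a * Gamma b) * (s powr (a - 1) * (1 - s) powr (b - 1))"
    using r by (simp add: power_kernel_def powr_mult powr_add[symmetric])
  then show ?thesis using True by (simp add: right_diff_distrib)
next
  case False
  have "r * s > 0 \<longleftrightarrow> s > 0" "r - r * s > 0 \<longleftrightarrow> s < 1"
    using r by (auto simp: zero_less_mult_iff)
  then show ?thesis using False by (auto simp: power_kernel_def indicator_def)
qed

lemma nn_integral_power_kernel_convolution:
  assumes a: "a > 0" and b: "b > 0"
  shows "(\<integral>\<^sup>+ y. ennreal (power_kernel a y * power_kernel b (r - y)) \<partial>lborel)
       = ennreal (power_kernel (a + b) r)"
    (is "(\<integral>\<^sup>+ y. ?f y \<partial>lborel) = _")
proof (cases "r > 0")
  case False
  then have "power_kernel a y * power_kernel b (r - y) = 0" for y by (simp add: power_kernel_def)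
  moreover have "power_kernel (a + b) r = 0" using False by (simp add: power_kernel_def)
  ultimately show ?thesis by (simp only: ennreal_0 nn_integral_const mult_zero_left)
next
  case r: True
  define c where "c = r powr (a + b - 2) / (Gamma a * Gamma b)"
  let ?beta = "\<lambda>s. indicator {0..1} s * (s powr (a - 1) * (1 - s) powr (b - 1))"
  have Gamma_pos: "Gamma a > 0" "Gamma b > 0" using a b by auto
  then have "c \<ge> 0" by (simp add: c_def)
  have "(\<integral>\<^sup>+ y. ?f y \<partial>lborel) = ennreal r * (\<integral>\<^sup>+ s. ?f (r * s) \<partial>lborel)"
    using nn_integral_real_affine[of ?f r 0] r by simp
  also have "\<dots> = ennreal r * (ennreal c * (\<integral>\<^sup>+ s. ennreal (?beta s) \<partial>lborel))"
    unfolding power_kernel_mult_scaled[OF r] c_def[symmetric] ennreal_mult'[OF \<open>c \<ge> 0\<close>]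
    by (subst nn_integral_cmult) auto
  also have "(\<integral>\<^sup>+ s. ennreal (?beta s) \<partial>lborel) = ennreal (Beta a b)"
    by (intro nn_integral_has_integral_lebesgue has_integral_Beta_real a b) auto
  also have "ennreal r * (ennreal c * ennreal (Beta a b)) = ennreal (r * (c * Beta a b))"
    using r \<open>c \<ge> 0\<close> by (simp add: ennreal_mult'[symmetric])
  also have "r * (c * Beta a b) = power_kernel (a + b) r"
    using r Gamma_pos powr_add[of r 1 "a + b - 2"] by (simp add: power_kernel_def c_def Beta_def)
  finally show ?thesis .
qed

lemma nn_integral_prod_power_kernel:
  fixes a :: "'i \<Rightarrow> real"
  assumes "finite J" "\<And>j. j \<in> J \<Longrightarrow> a j > 0" "b > 0"
  shows "(\<integral>\<^sup>+ t. ennreal ((\<Prod>j\<in>J. power_kernel (a j) (t j)) * power_kernel b (r - sum t J))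
            \<partial>(\<Pi>\<^sub>M j\<in>J. lborel))
       = ennreal (power_kernel (b + sum a J) r)"
proof -
  interpret product_sigma_finite "\<lambda>_::'i. lborel::real measure" by standard
  show ?thesis
    using assms
  proof (induction J arbitrary: b)
    case empty
    then show ?case by (simp add: PiM_empty nn_integral_count_space_finite)
  next
    case (insert i J)
    let ?f = "\<lambda>t. ennreal ((\<Prod>j\<in>insert i J. power_kernel (a j) (t j)) *
        power_kernel b (r - sum t (insert i J)))"
    have "?f (t(i := y)) = ennreal (\<Prod>j\<in>J. power_kernel (a j) (t j)) *
        ennreal (power_kernel (a i) y * power_kernel b ((r - sum t J) - y))" for t y
    proof -
      have "(\<Prod>j\<in>J. power_kernel (a j) ((t(i := y)) j)) = (\<Prod>j\<in>J. power_kernel (a j) (t j))"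
        "sum (t(i := y)) J = sum t J"
        using insert.hyps by (auto intro!: prod.cong sum.cong)
      then show ?thesis
        using insert.hyps insert.prems
        by (simp add: ennreal_mult'[symmetric] prod_nonneg diff_diff_eq mult_ac add_ac fun_upd_same
            del: fun_upd_apply)
    qed
    then have "(\<integral>\<^sup>+ t. ?f t \<partial>(\<Pi>\<^sub>M j\<in>insert i J. lborel))
        = (\<integral>\<^sup>+ t. ennreal (\<Prod>j\<in>J. power_kernel (a j) (t j)) *
            (\<integral>\<^sup>+ y. ennreal (power_kernel (a i) y * power_kernel b ((r - sum t J) - y)) \<partial>lborel)
          \<partial>(\<Pi>\<^sub>M j\<in>J. lborel))"
      using insert.hyps by (subst product_nn_integral_insert) (auto simp: nn_integral_cmult)
    also have "\<dots> = (\<integral>\<^sup>+ t.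
        ennreal ((\<Prod>j\<in>J. power_kernel (a j) (t j)) * power_kernel (b + a i) (r - sum t J))
        \<partial>(\<Pi>\<^sub>M j\<in>J. lborel))"
      using insert.prems
      by (subst nn_integral_power_kernel_convolution)
        (auto intro!: nn_integral_cong simp: ennreal_mult'[symmetric] prod_nonneg add.commute)
    also have "\<dots> = ennreal (power_kernel (b + a i + sum a J) r)"
      using insert.prems by (intro insert.IH) (auto intro: add_pos_pos)
    finally show ?case using insert.hyps by (simp add: add.assoc)
  qed
qed

locale dirichlet =
  fixes J :: "'i set" and k :: 'i and a :: "'i \<Rightarrow> real"
  assumes finite_J: "finite J" and k_notin_J: "k \<notin> J" and a_pos: "i \<in> insert k J \<Longrightarrow> a i > 0"
begin

abbreviation colours :: "'i set" where
  "colours \<equiv> insert k J"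

definition coord :: "('i \<Rightarrow> real) \<Rightarrow> 'i \<Rightarrow> real" where
  "coord t = t(k := 1 - sum t J)"

definition dirichlet_density :: "('i \<Rightarrow> real) \<Rightarrow> real" where
  "dirichlet_density t = Gamma (sum a colours) * (\<Prod>i\<in>colours. power_kernel (a i) (coord t i))"

definition dirichlet_measure :: "('i \<Rightarrow> real) measure" where
  "dirichlet_measure = density (\<Pi>\<^sub>M j\<in>J. lborel) (\<lambda>t. ennreal (dirichlet_density t))"

lemma sum_a_pos: "sum a colours > 0"
  using finite_J a_pos by (intro sum_pos) auto

lemma coord_J: "j \<in> J \<Longrightarrow> coord t j = t j"
  using k_notin_J by (auto simp: coord_def)

lemma sum_coord: "sum (coord t) colours = 1"
proof -
  have "sum (coord t) J = sum t J" by (intro sum.cong) (auto simp: coord_J)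
  then show ?thesis using finite_J k_notin_J by (simp add: coord_def)
qed

lemma coord_less_1:
  assumes pos: "\<forall>i\<in>colours. coord t i > 0" and j: "j \<in> J"
  shows "coord t j < 1"
proof -
  have "coord t j \<le> sum (coord t) J"
    using pos j finite_J by (intro member_le_sum) (auto intro: less_imp_le)
  also have "\<dots> < sum (coord t) colours" using pos finite_J k_notin_J by simp
  finally show ?thesis by (simp only: sum_coord)
qed

lemma prod_power_kernel_coord:
  "(\<Prod>i\<in>colours. power_kernel (b i) (coord t i))
    = (\<Prod>j\<in>J. power_kernel (b j) (t j)) * power_kernel (b k) (1 - sum t J)"
proof -
  have "(\<Prod>j\<in>J. power_kernel (b j) (coord t j)) = (\<Prod>j\<in>J. power_kernel (b j) (t j))"
    by (intro prod.cong) (auto simp: coord_J)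
  then show ?thesis
    using finite_J k_notin_J by (simp add: coord_def mult.commute)
qed

lemma dirichlet_density_nonneg: "dirichlet_density t \<ge> 0"
  unfolding dirichlet_density_def using sum_a_pos a_pos
  by (intro mult_nonneg_nonneg prod_nonneg) (auto simp: less_imp_le)

lemma measurable_coord:
  assumes "i \<in> colours"
  shows "(\<lambda>t. coord t i) \<in> borel_measurable (\<Pi>\<^sub>M j\<in>J. lborel)"
  using assms by (cases "i = k") (auto simp: coord_def)

lemma measurable_dirichlet_density [measurable]:
  "dirichlet_density \<in> borel_measurable (\<Pi>\<^sub>M j\<in>J. lborel)"
  unfolding dirichlet_density_def using measurable_coord
  by (intro borel_measurable_times borel_measurable_const borel_measurable_prod
      measurable_compose[OF _ measurable_power_kernel])

lemma sets_dirichlet_measure [measurable_cong, simp]: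
  "sets dirichlet_measure = sets (\<Pi>\<^sub>M j\<in>J. lborel)"
  by (simp add: dirichlet_measure_def)

lemma space_dirichlet_measure: "space dirichlet_measure = space (\<Pi>\<^sub>M j\<in>J. lborel)"
  by (simp add: dirichlet_measure_def)

lemma measurable_prod_coord_power:
  "(\<lambda>t. \<Prod>i\<in>colours. coord t i ^ m i) \<in> borel_measurable (\<Pi>\<^sub>M j\<in>J. lborel)"
  using measurable_coord by (intro borel_measurable_prod borel_measurable_power)

lemma AE_coord_pos: "AE t in dirichlet_measure. \<forall>i\<in>colours. coord t i > 0"
proof -
  have "coord t i > 0" if "dirichlet_density t > 0" "i \<in> colours" for t i
  proof -
    have "power_kernel (a i) (coord t i) \<noteq> 0"
    proof
      assume "power_kernel (a i) (coord t i) = 0"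
      then have "(\<Prod>i\<in>colours. power_kernel (a i) (coord t i)) = 0"
        using that(2) finite_J by (intro prod_zero) auto
      then show False using that(1) by (simp add: dirichlet_density_def del: prod.insert)
    qed
    then show ?thesis by (simp add: power_kernel_def split: if_splits)
  qed
  then show ?thesis
    unfolding dirichlet_measure_def by (subst AE_density) auto
qed

lemma dirichlet_density_mult_prod_coord_power:
  "dirichlet_density t * (\<Prod>i\<in>colours. coord t i ^ m i)
    = Gamma (sum a colours) * (\<Prod>i\<in>colours. pochhammer (a i) (m i)) *
      ((\<Prod>j\<in>J. power_kernel (a j + real (m j)) (t j)) * power_kernel (a k + real (m k)) (1 - sum t J))"
proof -
  have "dirichlet_density t * (\<Prod>i\<in>colours. coord t i ^ m i)
      = Gamma (sum a colours) * (\<Prod>i\<in>colours. coord t i ^ m i * power_kernel (a i) (coord t i))"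
    unfolding dirichlet_density_def by (simp only: prod.distrib mult_ac)
  also have "(\<Prod>i\<in>colours. coord t i ^ m i * power_kernel (a i) (coord t i))
      = (\<Prod>i\<in>colours. pochhammer (a i) (m i) * power_kernel (a i + real (m i)) (coord t i))"
    using a_pos by (intro prod.cong refl power_mult_power_kernel)
  finally show ?thesis by (simp only: prod.distrib prod_power_kernel_coord mult_ac)
qed

definition moment :: "('i \<Rightarrow> nat) \<Rightarrow> real" where
  "moment m = (\<Prod>i\<in>colours. pochhammer (a i) (m i)) / pochhammer (sum a colours) (sum m colours)"

lemma moment_nonneg: "moment m \<ge> 0"
  unfolding moment_def using a_pos sum_a_pos
  by (intro divide_nonneg_nonneg prod_nonneg) (auto intro!: less_imp_le[OF pochhammer_pos])

lemma nn_integral_prod_coord_power: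
  "(\<integral>\<^sup>+ t. ennreal (\<Prod>i\<in>colours. coord t i ^ m i) \<partial>dirichlet_measure) = ennreal (moment m)"
proof -
  define A where "A = sum a colours"
  define c where "c = Gamma A * (\<Prod>i\<in>colours. pochhammer (a i) (m i))"
  have "A > 0" unfolding A_def by (rule sum_a_pos)
  then have "Gamma A > 0" by (rule Gamma_real_pos)
  then have "Gamma A \<noteq> 0" by simp
  have "c \<ge> 0"
    unfolding c_def using \<open>Gamma A > 0\<close> a_pos
    by (intro mult_nonneg_nonneg prod_nonneg) (auto intro!: less_imp_le[OF pochhammer_pos])
  have "(\<integral>\<^sup>+ t. ennreal (\<Prod>i\<in>colours. coord t i ^ m i) \<partial>dirichlet_measure)
      = (\<integral>\<^sup>+ t. ennreal (dirichlet_density t * (\<Prod>i\<in>colours. coord t i ^ m i)) \<partial>(\<Pi>\<^sub>M j\<in>J. lborel))"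
    unfolding dirichlet_measure_def using measurable_prod_coord_power
    by (subst nn_integral_density) (auto simp: ennreal_mult' dirichlet_density_nonneg)
  also have "\<dots> = ennreal c * ennreal (power_kernel (a k + real (m k) + (\<Sum>j\<in>J. a j + real (m j))) 1)"
    unfolding dirichlet_density_mult_prod_coord_power A_def[symmetric] c_def[symmetric]
      ennreal_mult'[OF \<open>c \<ge> 0\<close>]
    using finite_J a_pos
    by (subst nn_integral_cmult) (auto simp: nn_integral_prod_power_kernel add_pos_nonneg)
  also have "a k + real (m k) + (\<Sum>j\<in>J. a j + real (m j)) = A + real (sum m colours)"
    using finite_J k_notin_J by (simp add: A_def sum.distrib)
  also have "ennreal c * ennreal (power_kernel (A + real (sum m colours)) 1)
      = ennreal (c / Gamma (A + real (sum m colours)))"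
    using \<open>c \<ge> 0\<close> by (simp add: power_kernel_def ennreal_mult'[symmetric])
  also have "Gamma (A + real (sum m colours)) = pochhammer A (sum m colours) * Gamma A"
    using \<open>A > 0\<close> \<open>Gamma A \<noteq> 0\<close> by (subst pochhammer_Gamma) (auto elim!: nonpos_Ints_cases)
  also have "c / (pochhammer A (sum m colours) * Gamma A)
      = (\<Prod>i\<in>colours. pochhammer (a i) (m i)) / pochhammer A (sum m colours)"
    using \<open>Gamma A \<noteq> 0\<close> by (simp add: c_def)
  finally show ?thesis unfolding A_def moment_def .
qed

sublocale prob_space dirichlet_measure
proof (rule prob_spaceI)
  show "emeasure dirichlet_measure (space dirichlet_measure) = 1"
    using nn_integral_prod_coord_power[of "\<lambda>_. 0"] by (simp add: moment_def)
qed

lemma dirichlet_density_fun_upd: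
  assumes j: "j \<in> J"
  shows "dirichlet_density (t(j := y)) = Gamma (sum a colours) * power_kernel (a j) y *
    ((\<Prod>l\<in>J - {j}. power_kernel (a l) (t l)) * power_kernel (a k) ((1 - y) - sum t (J - {j})))"
proof -
  have "(\<Prod>l\<in>J - {j}. power_kernel (a l) ((t(j := y)) l)) = (\<Prod>l\<in>J - {j}. power_kernel (a l) (t l))"
    "sum (t(j := y)) (J - {j}) = sum t (J - {j})"
    by (auto intro!: prod.cong sum.cong)
  then show ?thesis
    unfolding dirichlet_density_def prod_power_kernel_coord
    by (simp add: prod.remove[OF finite_J j] sum.remove[OF finite_J j] diff_diff_eq mult_ac fun_upd_same
        del: fun_upd_apply sum.insert)
qed

theorem nn_integral_marginal:
  assumes j: "j \<in> J" and f [measurable]: "f \<in> borel_measurable borel"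
  defines "A \<equiv> sum a colours"
  shows "(\<integral>\<^sup>+ t. f (t j) \<partial>dirichlet_measure)
       = (\<integral>\<^sup>+ y. ennreal (Gamma A * (power_kernel (a j) y * power_kernel (A - a j) (1 - y))) * f y
            \<partial>lborel)"
proof -
  interpret product_sigma_finite "\<lambda>_::'i. lborel::real measure" by standard
  let ?L = "J - {j}" and ?g = "\<lambda>t. ennreal (dirichlet_density t) * f (t j)"
  have J_eq: "insert j ?L = J" and L: "finite ?L" "j \<notin> ?L" using finite_J j by auto
  have "A > 0" unfolding A_def by (rule sum_a_pos)
  then have marginal_nonneg: "Gamma A * power_kernel (a j) y \<ge> 0" for y
    using a_pos j by (simp add: less_imp_le)
  have measurable: "?g \<in> borel_measurable (\<Pi>\<^sub>M j\<in>insert j ?L. lborel)"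
    using j unfolding J_eq by measurable
  have "(\<integral>\<^sup>+ t. f (t j) \<partial>dirichlet_measure) = (\<integral>\<^sup>+ t. ?g t \<partial>(\<Pi>\<^sub>M j\<in>J. lborel))"
    unfolding dirichlet_measure_def using j by (intro nn_integral_density) measurable
  also have "\<dots> = (\<integral>\<^sup>+ y. \<integral>\<^sup>+ t. ?g (t(j := y)) \<partial>(\<Pi>\<^sub>M l\<in>?L. lborel) \<partial>lborel)"
    using product_nn_integral_insert_rev[OF L measurable] unfolding J_eq .
  also have "\<dots> = (\<integral>\<^sup>+ y. \<integral>\<^sup>+ t. ennreal (Gamma A * power_kernel (a j) y) * f y *
      ennreal ((\<Prod>l\<in>?L. power_kernel (a l) (t l)) * power_kernel (a k) ((1 - y) - sum t ?L))
      \<partial>(\<Pi>\<^sub>M l\<in>?L. lborel) \<partial>lborel)"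
    unfolding dirichlet_density_fun_upd[OF j] A_def[symmetric] ennreal_mult'[OF marginal_nonneg]
    by (simp add: mult_ac)
  also have "\<dots> = (\<integral>\<^sup>+ y. ennreal (Gamma A * power_kernel (a j) y) * f y *
      ennreal (power_kernel (a k + sum a ?L) (1 - y)) \<partial>lborel)"
    using L a_pos by (subst nn_integral_cmult, measurable)
      (intro nn_integral_cong arg_cong2[of _ _ _ _ "(*)"] nn_integral_prod_power_kernel refl, auto)
  also have "a k + sum a ?L = A - a j"
    using finite_J k_notin_J j by (simp add: A_def sum.remove)
  finally show ?thesis
    unfolding mult.assoc[of "Gamma A", symmetric] ennreal_mult'[OF marginal_nonneg]
    by (simp only: mult_ac)
qed

lemma has_bochner_integral_prod_coord_colouring:
  assumes S: "finite S" and \<kappa>: "\<kappa> \<in> S \<rightarrow>\<^sub>E colours"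
  shows "has_bochner_integral dirichlet_measure (\<lambda>t. \<Prod>x\<in>S. coord t (\<kappa> x))
    (moment (\<lambda>i. card (colour_class S \<kappa> i)))"
proof -
  let ?m = "\<lambda>i. card (colour_class S \<kappa> i)"
  have "\<kappa> ` S \<subseteq> colours" "finite colours" using \<kappa> finite_J by auto
  then have prod_eq: "(\<Prod>x\<in>S. coord t (\<kappa> x)) = (\<Prod>i\<in>colours. coord t i ^ ?m i)" for t
    using prod.group[OF S, of colours \<kappa> "\<lambda>x. coord t (\<kappa> x)"] by simp
  have "AE t in dirichlet_measure. 0 \<le> (\<Prod>i\<in>colours. coord t i ^ ?m i)"
    using AE_coord_pos by eventually_elim (intro prod_nonneg, auto intro: less_imp_le)
  moreover have "(\<lambda>t. \<Prod>i\<in>colours. coord t i ^ ?m i) \<in> borel_measurable dirichlet_measure"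
    using measurable_prod_coord_power
    by (simp only: measurable_cong_sets[OF sets_dirichlet_measure refl])
  ultimately show ?thesis
    unfolding prod_eq using nn_integral_prod_coord_power[of ?m] moment_nonneg[of ?m]
    by (intro has_bochner_integral_nn_integral)
qed

definition lower_box :: "('i \<Rightarrow> real) \<Rightarrow> ('i \<Rightarrow> real) set" where
  "lower_box u = {t \<in> space dirichlet_measure. \<forall>j\<in>J. t j \<le> u j}"

lemma lower_box_in_events [measurable]: "lower_box u \<in> events"
  unfolding lower_box_def space_dirichlet_measure sets_dirichlet_measure using finite_J by measurable

definition capped_mass :: "'a set \<Rightarrow> ('i \<Rightarrow> real) \<Rightarrow> ('i \<Rightarrow> real) \<Rightarrow> real" where
  "capped_mass S u t = (\<Sum>\<kappa>\<in>capped_colourings colours J u S. \<Prod>x\<in>S. coord t (\<kappa> x))"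

lemma has_bochner_integral_capped_mass:
  assumes "finite S"
  shows "has_bochner_integral dirichlet_measure (capped_mass S u)
    (\<Sum>\<kappa>\<in>capped_colourings colours J u S. moment (\<lambda>i. card (colour_class S \<kappa> i)))"
  unfolding capped_mass_def using assms
  by (intro has_bochner_integral_sum has_bochner_integral_prod_coord_colouring)
    (auto simp: capped_colourings_def)

lemma AE_abs_capped_mass_diff_le:
  assumes "finite S"
  shows "AE t in dirichlet_measure. \<bar>capped_mass S u t - indicator (lower_box u) t\<bar>
    \<le> (\<Sum>j\<in>J. chebyshev_bound (real (card S)) (u j) (t j))"
  using AE_coord_pos AE_space
proof eventually_elim
  fix t assume pos: "\<forall>i\<in>colours. coord t i > 0" and t: "t \<in> space dirichlet_measure"
  have "\<bar>capped_mass S u t - of_bool (\<forall>j\<in>J. coord t j \<le> u j)\<bar>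
      \<le> (\<Sum>j\<in>J. chebyshev_bound (real (card S)) (u j) (coord t j))"
    unfolding capped_mass_def using pos coord_less_1[OF pos] finite_J assms sum_coord
    by (intro abs_sum_capped_colourings_diff_le) (auto intro: less_imp_le)
  moreover have "of_bool (\<forall>j\<in>J. coord t j \<le> u j) = (indicator (lower_box u) t :: real)"
    using t by (auto simp: coord_J indicator_def lower_box_def)
  ultimately show "\<bar>capped_mass S u t - indicator (lower_box u) t\<bar>
      \<le> (\<Sum>j\<in>J. chebyshev_bound (real (card S)) (u j) (t j))"
    by (simp add: coord_J)
qed

theorem abs_capped_colourings_diff_prob_le:
  assumes S: "finite S" and B: "B \<ge> 0" "\<And>j. j \<in> J \<Longrightarrow>
    (\<integral>\<^sup>+ t. ennreal (chebyshev_bound (real (card S)) (u j) (t j)) \<partial>dirichlet_measure) \<le> ennreal B"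
  shows "\<bar>(\<Sum>\<kappa>\<in>capped_colourings colours J u S. moment (\<lambda>i. card (colour_class S \<kappa> i)))
          - prob (lower_box u)\<bar> \<le> real (card J) * B"
proof -
  let ?d = "\<lambda>t. capped_mass S u t - indicator (lower_box u) t"
  let ?b = "\<lambda>j t. ennreal (chebyshev_bound (real (card S)) (u j) (t j))"
  have "has_bochner_integral dirichlet_measure (indicator (lower_box u)) (prob (lower_box u))"
    by (rule has_bochner_integral_real_indicator[OF lower_box_in_events])
      (simp add: emeasure_eq_measure)
  note has_integral_diff =
    has_bochner_integral_diff[OF has_bochner_integral_capped_mass[OF S, of u] this]
  have "AE t in dirichlet_measure. ennreal \<bar>?d t\<bar> \<le> (\<Sum>j\<in>J. ?b j t)"
    using AE_abs_capped_mass_diff_le[OF S, of u] AE_coord_pos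
  proof eventually_elim
    fix t assume abs_diff_le: "\<bar>?d t\<bar> \<le> (\<Sum>j\<in>J. chebyshev_bound (real (card S)) (u j) (t j))"
      and pos: "\<forall>i\<in>colours. coord t i > 0"
    have "chebyshev_bound (real (card S)) (u j) (t j) \<ge> 0" if "j \<in> J" for j
      using pos coord_less_1[OF pos that] that
      by (intro chebyshev_bound_nonneg) (auto simp: coord_J less_imp_le)
    then show "ennreal \<bar>?d t\<bar> \<le> (\<Sum>j\<in>J. ?b j t)"
      using abs_diff_le by (simp add: ennreal_leI)
  qed
  then have "(\<integral>\<^sup>+ t. ennreal \<bar>?d t\<bar> \<partial>dirichlet_measure)
      \<le> (\<integral>\<^sup>+ t. (\<Sum>j\<in>J. ?b j t) \<partial>dirichlet_measure)"
    by (rule nn_integral_mono_AE)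
  also have "\<dots> = (\<Sum>j\<in>J. \<integral>\<^sup>+ t. ?b j t \<partial>dirichlet_measure)"
    by (intro nn_integral_sum) measurable
  also have "\<dots> \<le> (\<Sum>j\<in>J. ennreal B)" by (intro sum_mono B)
  also have "\<dots> = ennreal (real (card J) * B)"
    by (simp add: ennreal_mult' ennreal_of_nat_eq_real_of_nat)
  finally have "(\<integral>t. \<bar>?d t\<bar> \<partial>dirichlet_measure) \<le> real (card J) * B"
    using B(1) by (intro integral_real_bounded) auto
  then show ?thesis
    using has_bochner_integral_integral_eq[OF has_integral_diff]
      integral_abs_bound[of dirichlet_measure ?d] by linarith
qed

lemma dirichlet_density_times_indicator_lower_box:
  assumes u: "sum u J \<le> 1" and t: "t \<in> space dirichlet_measure"
  shows "dirichlet_density t * indicator (lower_box u) t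
    = Gamma (sum a colours) / (\<Prod>i\<in>colours. Gamma (a i)) *
      (indicator (\<Pi>\<^sub>E j\<in>J. {0..u j}) t * ((\<Prod>j\<in>J. t j powr (a j - 1)) * (1 - sum t J) powr (a k - 1)))"
proof (cases "t \<in> (\<Pi>\<^sub>E j\<in>J. {0..u j})")
  case True
  then have bounds: "0 \<le> t j" "t j \<le> u j" if "j \<in> J" for j using that by auto
  have "sum t J \<le> 1" using u sum_mono[of J t u] bounds(2) by simp
  moreover have "(\<Prod>j\<in>J. power_kernel (a j) (t j)) = (\<Prod>j\<in>J. t j powr (a j - 1) / Gamma (a j))"
    using bounds by (intro prod.cong) (auto simp: power_kernel_eq)
  ultimately have "dirichlet_density t = Gamma (sum a colours) / (\<Prod>i\<in>colours. Gamma (a i)) *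
      ((\<Prod>j\<in>J. t j powr (a j - 1)) * (1 - sum t J) powr (a k - 1))"
    unfolding dirichlet_density_def prod_power_kernel_coord using finite_J k_notin_J
    by (simp add: power_kernel_eq prod_dividef del: sum.insert)
  moreover have "t \<in> lower_box u" using bounds t by (simp add: lower_box_def)
  ultimately show ?thesis using True by simp
next
  case False
  then obtain j where j: "j \<in> J" "t j < 0 \<or> t j > u j"
    using t by (force simp: space_dirichlet_measure space_PiM PiE_iff)
  have "(\<Prod>j\<in>J. power_kernel (a j) (t j)) = 0" if "t j < 0"
    using that j(1) finite_J by (intro prod_zero) (auto intro!: bexI[of _ j] simp: power_kernel_def)
  then have "dirichlet_density t = 0" if "t j < 0"
    using that by (simp add: dirichlet_density_def prod_power_kernel_coord)
  moreover have "t \<notin> lower_box u" if "t j > u j"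
    using that j(1) by (force simp: lower_box_def)
  ultimately show ?thesis using False j(2) by auto
qed

lemma prob_lower_box:
  assumes u: "sum u J \<le> 1"
  shows "prob (lower_box u) = Gamma (sum a colours) / (\<Prod>i\<in>colours. Gamma (a i)) *
      (LINT t : (\<Pi>\<^sub>E j\<in>J. {0..u j}) | (\<Pi>\<^sub>M j\<in>J. lborel).
         (\<Prod>j\<in>J. t j powr (a j - 1)) * (1 - sum t J) powr (a k - 1))"
proof -
  have "lower_box u \<subseteq> space dirichlet_measure" by (auto simp: lower_box_def)
  then have "prob (lower_box u) = (\<integral>t. indicator (lower_box u) t \<partial>dirichlet_measure)"
    by (simp add: Int_absorb2)
  also have "\<dots> = (\<integral>t. dirichlet_density t * indicator (lower_box u) t \<partial>(\<Pi>\<^sub>M j\<in>J. lborel))"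
    using lower_box_in_events[of u] unfolding sets_dirichlet_measure unfolding dirichlet_measure_def
    by (subst integral_density) (auto simp: dirichlet_density_nonneg)
  also have "\<dots> = (\<integral>t. Gamma (sum a colours) / (\<Prod>i\<in>colours. Gamma (a i)) *
      (indicator (\<Pi>\<^sub>E j\<in>J. {0..u j}) t * ((\<Prod>j\<in>J. t j powr (a j - 1)) * (1 - sum t J) powr (a k - 1)))
      \<partial>(\<Pi>\<^sub>M j\<in>J. lborel))"
    by (intro Bochner_Integration.integral_cong dirichlet_density_times_indicator_lower_box u)
      (auto simp: space_dirichlet_measure)
  finally show ?thesis by (simp add: set_lebesgue_integral_def)
qed

end

subsection \<open>The deviation probability under a beta distribution\<close>

text \<open>The product of the density of \<open>Beta(\<alpha>, 1 - \<alpha>)\<close> and \<open>chebyshev_bound n u\<close> is at most a constant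
  times this function near \<open>0\<close>, and times its mirror image near \<open>1\<close>, because \<open>\<alpha> - 1 \<le> - \<alpha>\<close>.\<close>

definition deviation_density :: "real \<Rightarrow> real \<Rightarrow> real \<Rightarrow> real \<Rightarrow> real" where
  "deviation_density \<alpha> n u y = y powr (\<alpha> - 1) * (y / (y + n * (y - u)\<^sup>2))"

lemma deviation_density_nonneg: "n \<ge> 0 \<Longrightarrow> y \<ge> 0 \<Longrightarrow> deviation_density \<alpha> n u y \<ge> 0"
  by (simp add: deviation_density_def)

lemma measurable_deviation_density [measurable]: "deviation_density \<alpha> n u \<in> borel_measurable borel"
  unfolding deviation_density_def by measurable

lemma deviation_density_le_powr:
  assumes "n \<ge> 0" "y \<ge> 0"
  shows "deviation_density \<alpha> n u y \<le> y powr (\<alpha> - 1)"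
proof -
  have "y powr (\<alpha> - 1) * (y / (y + n * (y - u)\<^sup>2)) \<le> y powr (\<alpha> - 1) * 1"
    using assms by (intro mult_left_mono divide_le_eq_1[THEN iffD2]) auto
  then show ?thesis by (simp add: deviation_density_def)
qed

lemma divide_add_mult_square_diff_le:
  fixes n u y :: real
  assumes "n > 0" "u \<ge> 0" "y > 0"
  shows "y / (y + n * (y - u)\<^sup>2) \<le> 1 / (1 + (sqrt (n * y) - sqrt (n * u))\<^sup>2)"
proof -
  let ?d = "sqrt (n * y) - sqrt (n * u)"
  have "n * (n * (y - u)\<^sup>2) = (?d * (sqrt (n * y) + sqrt (n * u)))\<^sup>2"
    using assms by (simp add: algebra_simps power2_eq_square real_sqrt_mult)
  also have "\<dots> \<ge> ?d\<^sup>2 * (sqrt (n * y))\<^sup>2"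
    unfolding power_mult_distrib using assms by (intro mult_left_mono power_mono) auto
  finally have "n * (?d\<^sup>2 * y) \<le> n * (n * (y - u)\<^sup>2)" using assms by (simp add: mult_ac)
  then have "?d\<^sup>2 * y \<le> n * (y - u)\<^sup>2" using assms by simp
  then have "y * (1 + ?d\<^sup>2) \<le> y + n * (y - u)\<^sup>2" by (simp add: algebra_simps)
  moreover have "1 + ?d\<^sup>2 > 0" by (smt (verit) zero_le_power2)
  ultimately show ?thesis using assms by (simp add: field_simps add_pos_nonneg)
qed

lemma deviation_density_le_of_inverse_le:
  fixes n u y \<alpha> :: real
  assumes "\<alpha> \<le> 1/2" "n > 0" "u \<ge> 0" "1 / n \<le> y"
  shows "deviation_density \<alpha> n u y
       \<le> n powr (1/2 - \<alpha>) * (1 / (sqrt y * (1 + (sqrt (n * y) - sqrt (n * u))\<^sup>2)))"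
proof -
  have y: "y > 0" using assms by (smt (verit) divide_pos_pos)
  have "y powr (\<alpha> - 1) = y powr (\<alpha> - 1/2) / sqrt y"
    using y by (simp add: powr_half_sqrt[symmetric] powr_diff[symmetric])
  also have "y powr (\<alpha> - 1/2) \<le> (1 / n) powr (\<alpha> - 1/2)"
    using assms by (intro powr_mono2') auto
  also have "\<dots> = n powr (1/2 - \<alpha>)" using assms by (simp add: powr_divide powr_minus_divide[symmetric])
  finally have "y powr (\<alpha> - 1) \<le> n powr (1/2 - \<alpha>) / sqrt y" using y by (simp add: divide_right_mono)
  then have "deviation_density \<alpha> n u y
      \<le> n powr (1/2 - \<alpha>) / sqrt y * (1 / (1 + (sqrt (n * y) - sqrt (n * u))\<^sup>2))"
    unfolding deviation_density_def using y assms
    by (intro mult_mono divide_add_mult_square_diff_le) auto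
  then show ?thesis by simp
qed

lemma nn_integral_powr_from_0:
  fixes c \<alpha> :: real
  assumes "\<alpha> > 0" "c \<ge> 0"
  shows "(\<integral>\<^sup>+ y. ennreal (y powr (\<alpha> - 1)) * indicator {0..c} y \<partial>lborel) = ennreal (c powr \<alpha> / \<alpha>)"
proof -
  have "((\<lambda>y. y powr (\<alpha> - 1)) has_integral c powr (\<alpha> - 1 + 1) / (\<alpha> - 1 + 1)) {0..c}"
    using assms by (intro has_integral_powr_from_0) auto
  then show ?thesis
    using nn_integral_has_integral_lebesgue[of "{0..c}" "\<lambda>y. y powr (\<alpha> - 1)"]
    by (simp add: ennreal_mult'' ennreal_indicator mult.commute)
qed

lemma nn_integral_arctan_sqrt_le:
  fixes n c d :: real
  assumes n: "n > 0" and c: "c > 0"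
  shows "(\<integral>\<^sup>+ y. ennreal (1 / (sqrt y * (1 + (sqrt (n * y) - d)\<^sup>2))) * indicator {c..} y \<partial>lborel)
       \<le> ennreal (2 * pi / sqrt n)"
proof -
  define F where "F y = 2 / sqrt n * arctan (sqrt (n * y) - d)" for y
  have "(\<integral>\<^sup>+ y. ennreal (1 / (sqrt y * (1 + (sqrt (n * y) - d)\<^sup>2))) * indicator {c..} y \<partial>lborel)
      = ennreal (2 / sqrt n * (pi / 2) - F c)"
  proof (rule nn_integral_FTC_atLeast)
    fix y assume "c \<le> y"
    then have y: "y > 0" using c by simp
    have "((\<lambda>y. sqrt (n * y) - d) has_real_derivative sqrt n / (2 * sqrt y)) (at y)"
      unfolding real_sqrt_mult using y by (auto intro!: derivative_eq_intros simp: field_simps)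
    then have "(F has_real_derivative
        2 / sqrt n * (inverse (1 + (sqrt (n * y) - d)\<^sup>2) * (sqrt n / (2 * sqrt y)))) (at y)"
      unfolding F_def by (intro DERIV_cmult DERIV_chain'[OF _ DERIV_arctan])
    also have "2 / sqrt n * (inverse (1 + (sqrt (n * y) - d)\<^sup>2) * (sqrt n / (2 * sqrt y)))
        = 1 / (sqrt y * (1 + (sqrt (n * y) - d)\<^sup>2))"
      using n by (simp add: inverse_eq_divide mult.commute)
    finally show "(F has_real_derivative 1 / (sqrt y * (1 + (sqrt (n * y) - d)\<^sup>2))) (at y)" .
    show "0 \<le> 1 / (sqrt y * (1 + (sqrt (n * y) - d)\<^sup>2))" using y by simp
  next
    have "filterlim (\<lambda>y. - d + sqrt (n * y)) at_top at_top"
      using n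
      by (intro filterlim_tendsto_add_at_top[OF tendsto_const] filterlim_compose[OF sqrt_at_top]
          filterlim_tendsto_pos_mult_at_top[OF tendsto_const] filterlim_ident)
    then show "(F \<longlongrightarrow> 2 / sqrt n * (pi / 2)) at_top"
      unfolding F_def by (intro tendsto_mult_left filterlim_compose[OF tendsto_arctan_at_top]) simp
  qed measurable
  also have "\<dots> \<le> ennreal (2 * pi / sqrt n)"
  proof (rule ennreal_leI)
    have "arctan (sqrt (n * c) - d) \<ge> - (pi / 2)" using arctan_lbound less_imp_le by blast
    then have "F c \<ge> 2 / sqrt n * (- (pi / 2))" unfolding F_def using n by (intro mult_left_mono) auto
    then show "2 / sqrt n * (pi / 2) - F c \<le> 2 * pi / sqrt n" by simp
  qed
  finally show ?thesis .
qed

lemma ennreal_deviation_density_le: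
  fixes n u y \<alpha> :: real
  assumes \<alpha>: "\<alpha> \<le> 1/2" and n: "n > 0" and u: "u \<ge> 0"
  shows "ennreal (deviation_density \<alpha> n u y) * indicator {0..} y
       \<le> ennreal (y powr (\<alpha> - 1)) * indicator {0..1 / n} y + ennreal (n powr (1/2 - \<alpha>)) *
          (ennreal (1 / (sqrt y * (1 + (sqrt (n * y) - sqrt (n * u))\<^sup>2))) * indicator {1 / n..} y)"
proof -
  consider "y < 0" | "0 \<le> y" "y < 1 / n" | "0 \<le> y" "1 / n \<le> y" by linarith
  then show ?thesis
  proof cases
    case 2
    then show ?thesis using deviation_density_le_powr[of n y \<alpha> u] n by (simp add: ennreal_leI)
  next
    case 3
    then have "ennreal (deviation_density \<alpha> n u y) \<le> ennreal (n powr (1/2 - \<alpha>)) *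
        ennreal (1 / (sqrt y * (1 + (sqrt (n * y) - sqrt (n * u))\<^sup>2)))"
      using deviation_density_le_of_inverse_le[OF \<alpha> n u]
      by (simp add: ennreal_mult'[symmetric] ennreal_leI)
    then show ?thesis using 3 by (simp add: add_increasing)
  qed simp
qed

lemma nn_integral_deviation_density_le:
  fixes n u \<alpha> :: real
  assumes \<alpha>: "0 < \<alpha>" "\<alpha> \<le> 1/2" and n: "n > 0" and u: "u \<ge> 0"
  shows "(\<integral>\<^sup>+ y. ennreal (deviation_density \<alpha> n u y) * indicator {0..} y \<partial>lborel)
       \<le> ennreal ((1 / \<alpha> + 2 * pi) * n powr (- \<alpha>))"
proof -
  define b where "b = n powr (1/2 - \<alpha>)"
  let ?h = "\<lambda>y. 1 / (sqrt y * (1 + (sqrt (n * y) - sqrt (n * u))\<^sup>2))"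
  have "(\<integral>\<^sup>+ y. ennreal (deviation_density \<alpha> n u y) * indicator {0..} y \<partial>lborel)
      \<le> (\<integral>\<^sup>+ y. ennreal (y powr (\<alpha> - 1)) * indicator {0..1 / n} y
            + ennreal b * (ennreal (?h y) * indicator {1 / n..} y) \<partial>lborel)"
    unfolding b_def using \<alpha>(2) n u by (intro nn_integral_mono ennreal_deviation_density_le)
  also have "\<dots> = ennreal ((1 / n) powr \<alpha> / \<alpha>)
      + ennreal b * (\<integral>\<^sup>+ y. ennreal (?h y) * indicator {1 / n..} y \<partial>lborel)"
    using \<alpha> n by (simp add: nn_integral_add nn_integral_cmult nn_integral_powr_from_0)
  also have "\<dots> \<le> ennreal ((1 / n) powr \<alpha> / \<alpha>) + ennreal b * ennreal (2 * pi / sqrt n)"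
    using n by (intro add_mono mult_left_mono nn_integral_arctan_sqrt_le) auto
  also have "\<dots> = ennreal ((1 / n) powr \<alpha> / \<alpha> + b * (2 * pi / sqrt n))"
    using \<alpha> n by (simp add: b_def ennreal_mult'[symmetric] ennreal_plus[symmetric] del: ennreal_plus)
  also have "b * (2 * pi / sqrt n) = 2 * pi * n powr (- \<alpha>)"
  proof -
    have "b / sqrt n = n powr (- \<alpha>)"
      using n by (simp add: b_def powr_half_sqrt[symmetric] powr_diff[symmetric])
    moreover have "b * (2 * pi / sqrt n) = 2 * pi * (b / sqrt n)" by simp
    ultimately show ?thesis by (simp only:)
  qed
  also have "(1 / n) powr \<alpha> / \<alpha> + 2 * pi * n powr (- \<alpha>) = (1 / \<alpha> + 2 * pi) * n powr (- \<alpha>)"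
    using n by (simp add: powr_divide powr_minus_divide add_divide_distrib mult.commute)
  finally show ?thesis .
qed

lemma powr_mult_chebyshev_bound_le_half:
  fixes \<alpha> \<beta> \<gamma> n u y :: real
  assumes y: "0 < y" "y \<le> 1/2" and \<beta>: "-1 \<le> \<beta>" "\<beta> \<le> 0" and \<gamma>: "\<alpha> - 1 \<le> \<gamma>" and n: "n \<ge> 0"
  shows "y powr \<gamma> * (1 - y) powr \<beta> * chebyshev_bound n u y \<le> 4 * deviation_density \<alpha> n u y"
proof -
  have "(1 - y) powr \<beta> \<le> (1/2) powr \<beta>" using y \<beta> by (intro powr_mono2') auto
  also have "\<dots> \<le> (1/2) powr (-1)" using \<beta> by (intro powr_mono') auto
  finally have "(1 - y) powr \<beta> \<le> 2" by (simp add: powr_minus)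
  moreover have "y powr \<gamma> \<le> y powr (\<alpha> - 1)" using y \<gamma> by (intro powr_mono') auto
  moreover define v d where "v = y * (1 - y)" and "d = n * (y - u)\<^sup>2"
  then have "0 < v" "v \<le> y" "0 \<le> d" using y n by (auto simp: mult_left_le)
  then have "v / (v + d) \<le> y / (y + d)"
    by (simp add: divide_le_eq le_divide_eq add_pos_nonneg distrib_left mult_left_mono mult.commute)
  then have "chebyshev_bound n u y \<le> 2 * (y / (y + d))"
    by (simp add: chebyshev_bound_def v_def d_def)
  ultimately have "y powr \<gamma> * (1 - y) powr \<beta> * chebyshev_bound n u y
      \<le> y powr (\<alpha> - 1) * 2 * (2 * (y / (y + d)))"
    using y n by (intro mult_mono) (auto intro: chebyshev_bound_nonneg)
  then show ?thesis by (simp add: deviation_density_def d_def)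
qed

lemma powr_mult_chebyshev_bound_le:
  fixes \<alpha> n u y :: real
  assumes \<alpha>: "0 < \<alpha>" "\<alpha> \<le> 1/2" and n: "n \<ge> 0" and y: "0 < y" "y < 1"
  shows "y powr (\<alpha> - 1) * (1 - y) powr (- \<alpha>) * chebyshev_bound n u y
       \<le> 4 * (deviation_density \<alpha> n u y + deviation_density \<alpha> n (1 - u) (1 - y))"
proof (cases "y \<le> 1/2")
  case True
  have "y powr (\<alpha> - 1) * (1 - y) powr (- \<alpha>) * chebyshev_bound n u y \<le> 4 * deviation_density \<alpha> n u y"
    using True assms by (intro powr_mult_chebyshev_bound_le_half) auto
  then show ?thesis using deviation_density_nonneg[of n "1 - y" \<alpha> "1 - u"] y n by simp
next
  case False
  have "(1 - y) powr (- \<alpha>) * (1 - (1 - y)) powr (\<alpha> - 1) * chebyshev_bound n (1 - u) (1 - y)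
      \<le> 4 * deviation_density \<alpha> n (1 - u) (1 - y)"
    using False assms by (intro powr_mult_chebyshev_bound_le_half) auto
  then show ?thesis
    using deviation_density_nonneg[of n y \<alpha> u] y n
    by (simp add: chebyshev_bound_reflect[of n u y] mult_ac)
qed

lemma power_kernel_mult_chebyshev_bound_le:
  fixes \<alpha> n u y :: real
  assumes \<alpha>: "0 < \<alpha>" "\<alpha> \<le> 1/2" and n: "n \<ge> 0" and y: "0 < y" "y < 1"
  shows "power_kernel \<alpha> y * power_kernel (1 - \<alpha>) (1 - y) * chebyshev_bound n u y
       \<le> 4 / (Gamma \<alpha> * Gamma (1 - \<alpha>)) *
         (deviation_density \<alpha> n u y + deviation_density \<alpha> n (1 - u) (1 - y))"
proof -
  have "Gamma \<alpha> * Gamma (1 - \<alpha>) > 0" using \<alpha> by simp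
  from divide_right_mono[OF powr_mult_chebyshev_bound_le[OF assms, of u] less_imp_le[OF this]]
  show ?thesis using y by (simp add: power_kernel_def)
qed

lemma nn_integral_reflect:
  fixes f :: "real \<Rightarrow> ennreal"
  assumes "f \<in> borel_measurable borel"
  shows "(\<integral>\<^sup>+ y. f (c - y) \<partial>lborel) = (\<integral>\<^sup>+ y. f y \<partial>lborel)"
  using nn_integral_real_affine[OF assms, of "-1" c] by simp

theorem nn_integral_beta_chebyshev_bound_le:
  fixes \<alpha> n u :: real
  assumes \<alpha>: "0 < \<alpha>" "\<alpha> \<le> 1/2" and n: "n > 0" and u: "0 \<le> u" "u \<le> 1"
  shows "(\<integral>\<^sup>+ y. ennreal (power_kernel \<alpha> y * power_kernel (1 - \<alpha>) (1 - y)) *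
            ennreal (chebyshev_bound n u y) \<partial>lborel)
       \<le> ennreal (8 * (1 / \<alpha> + 2 * pi) / (Gamma \<alpha> * Gamma (1 - \<alpha>)) * n powr (- \<alpha>))"
    (is "(\<integral>\<^sup>+ y. ?f y \<partial>lborel) \<le> _")
proof -
  define b where "b = 4 / (Gamma \<alpha> * Gamma (1 - \<alpha>))"
  define B where "B = (1 / \<alpha> + 2 * pi) * n powr (- \<alpha>)"
  let ?g = "\<lambda>u y. ennreal (deviation_density \<alpha> n u y) * indicator {0..} y"
  have "b \<ge> 0" "B \<ge> 0" using \<alpha> by (auto simp: b_def B_def less_imp_le)
  have pointwise: "?f y \<le> ennreal b * (?g u y + ?g (1 - u) (1 - y))" for y
  proof (cases "0 < y \<and> y < 1")
    case True
    then show ?thesis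
      using ennreal_leI[OF power_kernel_mult_chebyshev_bound_le[of \<alpha> n y u]] \<alpha> n \<open>b \<ge> 0\<close>
      by (simp add: b_def[symmetric] ennreal_mult' deviation_density_nonneg)
  next
    case False
    then have "power_kernel \<alpha> y * power_kernel (1 - \<alpha>) (1 - y) = 0" by (auto simp: power_kernel_def)
    then show ?thesis by (simp only: ennreal_0 mult_zero_left zero_le)
  qed
  have "(\<integral>\<^sup>+ y. ?f y \<partial>lborel) \<le> (\<integral>\<^sup>+ y. ennreal b * (?g u y + ?g (1 - u) (1 - y)) \<partial>lborel)"
    by (intro nn_integral_mono pointwise)
  also have "\<dots> = ennreal b * ((\<integral>\<^sup>+ y. ?g u y \<partial>lborel) + (\<integral>\<^sup>+ y. ?g (1 - u) (1 - y) \<partial>lborel))"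
    by (simp add: nn_integral_cmult nn_integral_add)
  also have "(\<integral>\<^sup>+ y. ?g (1 - u) (1 - y) \<partial>lborel) = (\<integral>\<^sup>+ y. ?g (1 - u) y \<partial>lborel)"
    by (rule nn_integral_reflect) measurable
  also have "ennreal b * ((\<integral>\<^sup>+ y. ?g u y \<partial>lborel) + \<dots>) \<le> ennreal b * (ennreal B + ennreal B)"
    unfolding B_def using \<alpha> n u
    by (intro mult_left_mono add_mono nn_integral_deviation_density_le) auto
  also have "\<dots> = ennreal (b * (B + B))"
    using \<open>b \<ge> 0\<close> \<open>B \<ge> 0\<close> by (simp only: ennreal_mult' ennreal_plus)
  also have "b * (B + B) = 8 * (1 / \<alpha> + 2 * pi) / (Gamma \<alpha> * Gamma (1 - \<alpha>)) * n powr (- \<alpha>)"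
    by (simp add: b_def B_def)
  finally show ?thesis .
qed

subsection \<open>The symmetric case\<close>

locale symmetric_dirichlet =
  fixes k :: nat
  assumes k_ge_2: "k \<ge> 2"
begin

sublocale dirichlet "{1..<k}" k "\<lambda>_. 1 / real k"
  by unfold_locales (use k_ge_2 in auto)

lemma colours_eq: "insert k {1..<k} = {1..k}"
  using k_ge_2 by auto

lemma sum_parameters_eq_1: "(\<Sum>i\<in>insert k {1..<k}. 1 / real k) = 1"
  unfolding colours_eq using k_ge_2 by simp

lemma dirichlet_cdf_eq_prob_lower_box:
  assumes "(\<Sum>i\<in>{1..<k}. u i) \<le> 1"
  shows "dirichlet_cdf k u = prob (lower_box u)"
proof -
  have "(\<Prod>i\<in>insert k {1..<k}. Gamma (1 / real k)) = Gamma (1 / real k) ^ k"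
    unfolding colours_eq by simp
  then show ?thesis
    unfolding prob_lower_box[OF assms] sum_parameters_eq_1 dirichlet_cdf_def by simp
qed

lemma average_invariant_tuples_eq:
  "1 / fact n * (\<Sum>\<sigma> | \<sigma> permutes {1..n}.
      1 / real (tau k n \<sigma>) * real (card (invariant_tuples k n u \<sigma>)))
   = (\<Sum>\<kappa>\<in>capped_colourings colours {1..<k} u {1..n}. moment (\<lambda>i. card (colour_class {1..n} \<kappa> i)))"
proof -
  have "moment (\<lambda>i. card (colour_class {1..n} \<kappa> i))
      = (\<Prod>i\<in>{1..k}. pochhammer (1 / real k) (card (colour_class {1..n} \<kappa> i))) / fact n"
    if "\<kappa> \<in> capped_colourings colours {1..<k} u {1..n}" for \<kappa>
  proof -
    have card_eq: "(\<Sum>i\<in>colours. card (colour_class {1..n} \<kappa> i)) = card {1..n}"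
      using that by (intro sum_card_colour_class) (auto simp: capped_colourings_def)
    show ?thesis
      unfolding moment_def sum_parameters_eq_1 card_eq unfolding colours_eq
      by (simp add: pochhammer_fact)
  qed
  then show ?thesis
    unfolding sum_invariant_tuples colours_eq by (simp add: sum_divide_distrib)
qed

lemma nn_integral_chebyshev_bound_coordinate_le:
  assumes n: "n > 0" and u: "0 \<le> u" "u \<le> 1" and j: "j \<in> {1..<k}"
  shows "(\<integral>\<^sup>+ t. ennreal (chebyshev_bound n u (t j)) \<partial>dirichlet_measure)
       \<le> ennreal (8 * (k + 2 * pi) / (Gamma (1 / k) * Gamma (1 - 1 / k)) * n powr (- (1 / k)))"
proof -
  have "(\<integral>\<^sup>+ t. ennreal (chebyshev_bound n u (t j)) \<partial>dirichlet_measure)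
      = (\<integral>\<^sup>+ y. ennreal (power_kernel (1 / k) y * power_kernel (1 - 1 / k) (1 - y))
          * ennreal (chebyshev_bound n u y) \<partial>lborel)"
    unfolding nn_integral_marginal[OF j measurable_compose[OF measurable_chebyshev_bound
          measurable_ennreal]] sum_parameters_eq_1
    by simp
  also have "\<dots> \<le> ennreal (8 * (1 / (1 / k) + 2 * pi) / (Gamma (1 / k) * Gamma (1 - 1 / k))
      * n powr (- (1 / k)))"
    using k_ge_2 n u by (intro nn_integral_beta_chebyshev_bound_le) (auto simp: field_simps)
  finally show ?thesis by simp
qed

end

theorem theorem3:
  fixes k :: nat
  assumes "k \<ge> 2"
  shows "\<exists>C::real. \<forall>n::nat. \<forall>u::nat \<Rightarrow> real.
           n \<ge> 1 \<longrightarrow> (\<forall>i\<in>{1..<k}. u i \<ge> 0) \<longrightarrow> (\<Sum>i\<in>{1..<k}. u i) \<le> 1 \<longrightarrow>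
           \<bar>1 / fact n * (\<Sum>\<sigma> | \<sigma> permutes {1..n}.
                1 / real (tau k n \<sigma>) * real (card (invariant_tuples k n u \<sigma>)))
              - dirichlet_cdf k u\<bar> \<le> C * real n powr (- 1 / real k)"
proof -
  interpret symmetric_dirichlet k by unfold_locales (rule assms)
  define C where "C = 8 * (k + 2 * pi) / (Gamma (1 / k) * Gamma (1 - 1 / k))"
  have "C \<ge> 0" using assms by (simp add: C_def less_imp_le)
  show ?thesis
  proof (intro exI[of _ "(k - 1) * C"] allI impI)
    fix n :: nat and u :: "nat \<Rightarrow> real"
    assume n: "n \<ge> 1" and u: "\<forall>i\<in>{1..<k}. u i \<ge> 0" "(\<Sum>i\<in>{1..<k}. u i) \<le> 1"
    have "u j \<le> 1" if "j \<in> {1..<k}" for j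
      using member_le_sum[OF that, of u] u by force
    then have "(\<integral>\<^sup>+ t. ennreal (chebyshev_bound n (u j) (t j)) \<partial>dirichlet_measure)
        \<le> ennreal (C * n powr (- (1 / k)))" if "j \<in> {1..<k}" for j
      unfolding C_def using n u(1) that by (intro nn_integral_chebyshev_bound_coordinate_le) auto
    then show "\<bar>1 / fact n * (\<Sum>\<sigma> | \<sigma> permutes {1..n}.
          1 / real (tau k n \<sigma>) * real (card (invariant_tuples k n u \<sigma>))) - dirichlet_cdf k u\<bar>
        \<le> (k - 1) * C * real n powr (- 1 / real k)"
      unfolding average_invariant_tuples_eq dirichlet_cdf_eq_prob_lower_box[OF u(2)]
      using abs_capped_colourings_diff_prob_le[of "{1..n}" "C * n powr (- (1 / k))" u] \<open>C \<ge> 0\<close>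
      by simp
  qed
qed

end
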